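(* For every $\epsilon>0$ there exist an integer $n\ge 2$ and nonnegative distances $d=(d_e)_{e\in E}$ on the edges of the complete directed graph $K_n=(V,E)$ satisfying the triangle inequality ($d_{(u,w)}\le d_{(u,v)}+d_{(v,w)}$ for all distinct $u,v,w$) such that \[\frac{\min_{x\in AT^{\mathrm{int}}(K_n)} d\cdot x}{\min_{x\in N(AT_{\mathrm{bal}}(K_n))} d\cdot x}\;\ge\;\frac32-\epsilon .\] That is, the integrality gap of one round of the Lovász–Schrijver procedure (equivalently, one round of the Sherali–Adams procedure) applied to the balanced standard relaxation of the asymmetric TSP tour problem is at least $3/2-o(1)$.
   Context: The complete directed graph $K_n=(V,E)$ has $n$ nodes, both edges $(u,v),(v,u)$ for every pair of distinct nodes, and no self-loops. For $S\subseteq V$, $\delta^+(S)$ is the set of edges leaving $S$ and $\delta^-(S)$ the set of edges entering $S$; $\delta^\pm(v)=\delta^\pm(\{v\})$. For $F\subseteq E$ and $x\in\mathbb{R}^E$, $x(F)=\sum_{e\in F}x_e$, and $d\cdot x=\sum_e d_ex_e$. $AT^{\mathrm{int}}(K_n)$ is the set of $x\in\{0,1\}^E$ satisfying $x(\delta^+(S))\ge1$ and $x(\delta^-(S))\ge1$ for all $\emptyset\subsetneq S\subsetneq V$, and $x(\delta^+(v))=x(\delta^-(v))=1$ for all $v\in V$ (these are exactly the incidence vectors of Hamiltonian cycles). The balanced asymmetric tour polytope $AT_{\mathrm{bal}}(K_n)$ is the set of $x\in[0,1]^E$ with $x(\delta^+(S))\ge1$ and $x(\delta^-(S))\ge1$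 for all $\emptyset\subsetneq S\subsetneq V$, and $x(\delta^+(v))=x(\delta^-(v))$ for all $v\in V$. Lovász–Schrijver operator: for a convex set $R\subseteq[0,1]^m$, let $\mathrm{cone}(R)=\{(\lambda,\lambda x_1,\dots,\lambda x_m):\lambda\ge0,\ (x_1,\dots,x_m)\in R\}$, with the first coordinate indexed by $0$. A point $x\in[0,1]^m$ lies in $N(R)$ iff there is an $(m+1)\times(m+1)$ real matrix $X$ (rows/columns indexed $0,1,\dots,m$, row $i$ denoted $X_i$) such that (i) $X$ is symmetric, (ii) $X_0=\mathrm{diag}(X)=(1,x)$, and (iii) $X_i\in\mathrm{cone}(R)$ and $X_0-X_i\in\mathrm{cone}(R)$ for every $i\in\{1,\dots,m\}$. Here $m=|E|$ and coordinates are indexed by $E$. *)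

theory Defs
  imports Complex_Main "HOL-Library.FuncSet"
begin

definition K_verts :: "nat \<Rightarrow> nat set" where
  "K_verts n = {..<n}"

definition K_edges :: "nat \<Rightarrow> (nat \<times> nat) set" where
  "K_edges n = {(u, v). u \<in> K_verts n \<and> v \<in> K_verts n \<and> u \<noteq> v}"

definition cut_out :: "nat \<Rightarrow> nat set \<Rightarrow> (nat \<times> nat) set" where
  "cut_out n S = {(u, v) \<in> K_edges n. u \<in> S \<and> v \<notin> S}"

definition cut_in :: "nat \<Rightarrow> nat set \<Rightarrow> (nat \<times> nat) set" where
  "cut_in n S = {(u, v) \<in> K_edges n. u \<notin> S \<and> v \<in> S}"

definition tour_cost :: "nat \<Rightarrow> (nat \<times> nat \<Rightarrow> real) \<Rightarrow> (nat \<times> nat \<Rightarrow> real) \<Rightarrow> real" where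
  "tour_cost n d x = (\<Sum>e\<in>K_edges n. d e * x e)"

text \<open>Vectors indexed by a finite set \<open>E\<close> are functions that are \<open>undefined\<close> outside \<open>E\<close>,
  so that \<open>E \<rightarrow>\<^sub>E {0..1}\<close> is the cube \<open>[0,1]\<close> to the power \<open>E\<close>.\<close>

definition AT_int :: "nat \<Rightarrow> (nat \<times> nat \<Rightarrow> real) set" where
  "AT_int n = {x \<in> K_edges n \<rightarrow>\<^sub>E {0, 1}.
     (\<forall>S. S \<noteq> {} \<and> S \<subset> K_verts n \<longrightarrow> sum x (cut_out n S) \<ge> 1 \<and> sum x (cut_in n S) \<ge> 1) \<and>
     (\<forall>v\<in>K_verts n. sum x (cut_out n {v}) = 1 \<and> sum x (cut_in n {v}) = 1)}"

definition AT_bal :: "nat \<Rightarrow> (nat \<times> nat \<Rightarrow> real) set" where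
  "AT_bal n = {x \<in> K_edges n \<rightarrow>\<^sub>E {0..1}.
     (\<forall>S. S \<noteq> {} \<and> S \<subset> K_verts n \<longrightarrow> sum x (cut_out n S) \<ge> 1 \<and> sum x (cut_in n S) \<ge> 1) \<and>
     (\<forall>v\<in>K_verts n. sum x (cut_out n {v}) = sum x (cut_in n {v}))}"

text \<open>The homogenising coordinate \<open>0\<close> is \<open>None\<close>; the coordinate of \<open>e \<in> E\<close> is \<open>Some e\<close>.
  Entries at indices outside \<open>insert None (Some ` E)\<close> are irrelevant.\<close>

definition ls_cone :: "'e set \<Rightarrow> ('e \<Rightarrow> real) set \<Rightarrow> ('e option \<Rightarrow> real) set" where
  "ls_cone E R = {y. \<exists>l\<ge>0. \<exists>x\<in>R. y None = l \<and> (\<forall>e\<in>E. y (Some e) = l * x e)}"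

definition LS_N :: "'e set \<Rightarrow> ('e \<Rightarrow> real) set \<Rightarrow> ('e \<Rightarrow> real) set" where
  "LS_N E R = {x \<in> E \<rightarrow>\<^sub>E {0..1}. \<exists>X :: 'e option \<Rightarrow> 'e option \<Rightarrow> real.
     (\<forall>i\<in>insert None (Some ` E). \<forall>j\<in>insert None (Some ` E). X i j = X j i) \<and>
     X None None = 1 \<and>
     (\<forall>e\<in>E. X None (Some e) = x e \<and> X (Some e) (Some e) = x e) \<and>
     (\<forall>e\<in>E. X (Some e) \<in> ls_cone E R \<and> (\<lambda>j. X None j - X (Some e) j) \<in> ls_cone E R)}"

end

theory Submission
  imports Defs
begin

text \<open>
  The instances are ring graphs in the style of Charikar, Goemans and Karloff. A ring of level
  \<open>k + 1\<close> consists of two terminals and \<open>r\<close> copies of the ring of level \<open>k\<close>, joined by a forward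
  path through the entries and a backward path through the exits of the copies, with arcs of
  weight \<open>r ^ k\<close>. Its arcs split into closed trails such that the removal of any single trail
  leaves the graph strongly connected. Hence one can give every arc the value \<open>2/3\<close>: conditioned
  on an arc being absent its trail is absent and all other arcs have value \<open>1\<close>, conditioned on
  it being present its trail has value \<open>1\<close> and all other arcs have value \<open>1/2\<close>.
  A tour, rerouted along the graph, is a connected integral circulation. If its net flow
  through a ring is zero, each pair of parallel arcs is used in both directions or (at most once)
  not at all; a copy with nonzero net flow saves at most one arc weight of its parent ring but
  forces the usage of the arcs around it to change, which costs as much. By induction over the
  levels every tour costs almost the total weight of the graph, so the ratio tends to \<open>3/2\<close>.
\<close>

section \<open>Attainment of the minima\<close>

lemma finite_K_edges [simp]: "finite (K_edges n)"
proof (rule finite_subset)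
  show "K_edges n \<subseteq> {..<n} \<times> {..<n}"
    by (auto simp: K_edges_def K_verts_def)
qed simp

section \<open>Cuts and the cone over the balanced polytope\<close>

lemma cut_subset: "cut_out n S \<subseteq> K_edges n" "cut_in n S \<subseteq> K_edges n"
  by (auto simp: cut_out_def cut_in_def)

lemma finite_cut [simp]: "finite (cut_out n S)" "finite (cut_in n S)"
  by (rule finite_subset[OF cut_subset(1)], simp, rule finite_subset[OF cut_subset(2)], simp)

lemma cut_in_eq_cut_out_compl: "cut_in n S = cut_out n (K_verts n - S)"
  by (auto simp: cut_out_def cut_in_def K_edges_def)

lemma cut_singleton:
  "cut_out n {v} = {e \<in> K_edges n. fst e = v}" "cut_in n {v} = {e \<in> K_edges n. snd e = v}"
  by (auto simp: cut_out_def cut_in_def K_edges_def)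

text \<open>Nonemptiness is what puts the zero vector into the cone. Reversing edges maps
  \<open>cut_out n {v}\<close> onto \<open>cut_in n {v}\<close>, so the all-ones point is
  balanced.\<close>

lemma AT_bal_nonempty: "(\<lambda>e\<in>K_edges n. 1) \<in> AT_bal n"
proof -
  have s: "sum (\<lambda>e\<in>K_edges n. 1) F = real (card F)" if "F \<subseteq> K_edges n" for F
  proof -
    have "sum (\<lambda>e\<in>K_edges n. 1::real) F = (\<Sum>e\<in>F. 1)"
      by (rule sum.cong) (use that in auto)
    then show ?thesis by simp
  qed
  have out: "card (cut_out n S) \<ge> 1" if S: "S \<noteq> {}" "S \<subset> K_verts n" for S
  proof -
    obtain u v where "u \<in> S" "v \<in> K_verts n" "v \<notin> S" using S by blast
    then have "(u, v) \<in> cut_out n S" using S by (auto simp: cut_out_def K_edges_def)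
    then show ?thesis using card_gt_0_iff[of "cut_out n S"] by fastforce
  qed
  have inn: "card (cut_in n S) \<ge> 1" if "S \<noteq> {}" "S \<subset> K_verts n" for S
    unfolding cut_in_eq_cut_out_compl by (rule out) (use that in auto)
  have "cut_in n {v} = prod.swap ` cut_out n {v}" for v
    by (force simp: cut_in_def cut_out_def K_edges_def image_iff)
  then have "card (cut_in n {v}) = card (cut_out n {v})" for v
    by (metis card_image inj_swap)
  then show ?thesis
    unfolding AT_bal_def mem_Collect_eq s[OF cut_subset(1)] s[OF cut_subset(2)]
    using out inn by auto
qed

text \<open>Replaces the existential in \<open>ls_cone\<close> by homogeneous linear conditions,
  which pass to limits and are checked without division. At height 0 the bounds force every
  coordinate to vanish, so any point of \<open>AT_bal n\<close> is a witness; at positive height one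
  rescales.\<close>

lemma ls_cone_AT_bal_iff:
  "y \<in> ls_cone (K_edges n) (AT_bal n) \<longleftrightarrow>
     0 \<le> y None \<and> (\<forall>e\<in>K_edges n. 0 \<le> y (Some e) \<and> y (Some e) \<le> y None) \<and>
     (\<forall>S. S \<noteq> {} \<and> S \<subset> K_verts n \<longrightarrow>
        y None \<le> (\<Sum>e\<in>cut_out n S. y (Some e)) \<and> y None \<le> (\<Sum>e\<in>cut_in n S. y (Some e))) \<and>
     (\<forall>v\<in>K_verts n. (\<Sum>e\<in>cut_out n {v}. y (Some e)) = (\<Sum>e\<in>cut_in n {v}. y (Some e)))"
  (is "_ \<longleftrightarrow> ?H")
proof
  assume "y \<in> ls_cone (K_edges n) (AT_bal n)"
  then obtain x where l: "y None \<ge> 0" and x: "x \<in> AT_bal n"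
    and y: "\<And>e. e \<in> K_edges n \<Longrightarrow> y (Some e) = y None * x e"
    by (auto simp: ls_cone_def)
  have s: "(\<Sum>e\<in>F. y (Some e)) = y None * sum x F" if "F \<subseteq> K_edges n" for F
    unfolding sum_distrib_left by (rule sum.cong) (use that y in auto)
  have x01: "0 \<le> x e \<and> x e \<le> 1" if "e \<in> K_edges n" for e
    using x that by (auto simp: AT_bal_def PiE_iff)
  show ?H
    using l x x01 mult_left_mono[OF _ l, of 1]
    by (auto simp: y s cut_subset AT_bal_def mult_left_le)
next
  assume H: ?H
  show "y \<in> ls_cone (K_edges n) (AT_bal n)"
  proof (cases "y None = 0")
    case True
    with H have "\<forall>e\<in>K_edges n. y (Some e) = 0" by force
    with True AT_bal_nonempty[of n] show ?thesis by (auto simp: ls_cone_def)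
  next
    case False
    with H have pos: "y None > 0" by simp
    let ?x = "\<lambda>e\<in>K_edges n. y (Some e) / y None"
    have s: "sum ?x F = (\<Sum>e\<in>F. y (Some e)) / y None" if "F \<subseteq> K_edges n" for F
      unfolding sum_divide_distrib by (rule sum.cong) (use that in auto)
    have "?x \<in> AT_bal n"
      unfolding AT_bal_def mem_Collect_eq s[OF cut_subset(1)] s[OF cut_subset(2)]
      using H pos by (auto simp: field_simps)
    moreover have "\<forall>e\<in>K_edges n. y (Some e) = y None * ?x e" using pos by simp
    moreover have "y None \<ge> 0" using pos by simp
    ultimately show ?thesis unfolding ls_cone_def mem_Collect_eq by metis
  qed
qed

text \<open>Bolzano-Weierstrass in finitely many coordinates: for each new coordinate a monotone,
  hence convergent, subsequence is extracted.\<close>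

lemma finite_pointwise_convergent_subseq:
  fixes s :: "nat \<Rightarrow> 'a \<Rightarrow> real"
  assumes "finite J" "\<And>m j. j \<in> J \<Longrightarrow> \<bar>s m j\<bar> \<le> B"
  shows "\<exists>g. strict_mono g \<and> (\<forall>j\<in>J. convergent (\<lambda>m. s (g m) j))"
  using assms
proof (induction J rule: finite_induct)
  case empty
  show ?case using strict_mono_id by auto
next
  case (insert j J)
  then obtain g where g: "strict_mono g" "\<forall>j\<in>J. convergent (\<lambda>m. s (g m) j)" by blast
  obtain h :: "nat \<Rightarrow> nat" where h: "strict_mono h" "monoseq (\<lambda>m. s (g (h m)) j)"
    using seq_monosub[of "\<lambda>m. s (g m) j"] by auto
  have "Bseq (\<lambda>m. s (g (h m)) j)"
    by (rule BseqI'[of _ B]) (use insert.prems in auto)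
  then have "convergent (\<lambda>m. s (g (h m)) j)" using h(2) Bseq_monoseq_convergent by blast
  moreover have "convergent (\<lambda>m. s (g (h m)) i)" if "i \<in> J" for i
    using convergent_subseq_convergent[OF _ h(1), of "\<lambda>m. s (g m) i"] g(2) that
    by (simp add: o_def)
  moreover have "strict_mono (g \<circ> h)" using g(1) h(1) by (rule strict_mono_o)
  ultimately show ?case by (intro exI[of _ "g \<circ> h"]) (auto simp: o_def)
qed

text \<open>\<open>LS_N\<close> is a projection of a compact set of matrices. A minimising sequence
  is therefore followed together with its certificate matrices; along a subsequence where all
  entries converge, the limit matrix certifies the limit point.\<close>

lemma LS_N_attains_min:
  assumes "LS_N (K_edges n) (AT_bal n) \<noteq> {}"
  shows "\<exists>y. is_arg_min (tour_cost n d) (\<lambda>z. z \<in> LS_N (K_edges n) (AT_bal n)) y"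
proof -
  let ?N = "LS_N (K_edges n) (AT_bal n)" and ?K = "K_edges n"
  let ?I = "insert None (Some ` K_edges n)"
  define m where "m = (INF y\<in>?N. tour_cost n d y)"
  have bdd: "bdd_below (tour_cost n d ` ?N)"
  proof (rule bdd_belowI2)
    fix y assume "y \<in> ?N"
    then have y: "\<And>e. e \<in> ?K \<Longrightarrow> y e \<in> {0..1}" by (auto simp: LS_N_def)
    show "(\<Sum>e\<in>?K. - \<bar>d e\<bar>) \<le> tour_cost n d y"
      unfolding tour_cost_def
    proof (rule sum_mono)
      fix e assume "e \<in> ?K"
      then have "\<bar>d e * y e\<bar> \<le> \<bar>d e\<bar>" using y by (auto simp: abs_mult mult_left_le)
      then show "- \<bar>d e\<bar> \<le> d e * y e" by linarith
    qed
  qed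
  have "\<exists>y\<in>?N. tour_cost n d y < m + inverse (real (Suc k))" for k
    using cInf_lessD[of "tour_cost n d ` ?N" "m + inverse (real (Suc k))"] assms
    by (force simp: m_def)
  then obtain Y where Y: "\<And>k. Y k \<in> ?N" "\<And>k. tour_cost n d (Y k) < m + inverse (real (Suc k))"
    by metis
  define P where "P k X \<longleftrightarrow>
     (\<forall>i\<in>?I. \<forall>j\<in>?I. X i j = X j i) \<and> X None None = 1 \<and>
     (\<forall>e\<in>?K. X None (Some e) = Y k e \<and> X (Some e) (Some e) = Y k e) \<and>
     (\<forall>e\<in>?K. X (Some e) \<in> ls_cone ?K (AT_bal n) \<and>
        (\<lambda>j. X None j - X (Some e) j) \<in> ls_cone ?K (AT_bal n))" for k X
  have "\<forall>k. \<exists>X. P k X"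
    using Y(1) unfolding LS_N_def P_def by blast
  then obtain X where X: "\<And>k. P k (X k)" using choice[of P] by blast
  have X1: "\<And>k i j. i \<in> ?I \<Longrightarrow> j \<in> ?I \<Longrightarrow> X k i j = X k j i"
    and X2: "\<And>k. X k None None = 1"
    and X3: "\<And>k e. e \<in> ?K \<Longrightarrow> X k None (Some e) = Y k e \<and> X k (Some e) (Some e) = Y k e"
    and X4: "\<And>k e. e \<in> ?K \<Longrightarrow> X k (Some e) \<in> ls_cone ?K (AT_bal n)"
    and X5: "\<And>k e. e \<in> ?K \<Longrightarrow> (\<lambda>j. X k None j - X k (Some e) j) \<in> ls_cone ?K (AT_bal n)"
    using X unfolding P_def by blast+
  have Y01: "0 \<le> Y k e \<and> Y k e \<le> 1" if "e \<in> ?K" for k e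
    using Y(1)[of k] that by (auto simp: LS_N_def)
  \<comment> \<open>Row \<open>e\<close> lies in the cone, so its entries are at most its height
    \<open>X k (Some e) None\<close>, which is \<open>Y k e\<close> by symmetry.\<close>
  have b: "\<bar>X k i j\<bar> \<le> 1" if "i \<in> ?I" "j \<in> ?I" for k i j
  proof (cases i)
    case None
    then show ?thesis using that X2 X3 Y01 by auto
  next
    case i: (Some e)
    then have e: "e \<in> ?K" using that by auto
    then have "X k i None \<le> 1" "0 \<le> X k i None"
      using X1[of i None k] X3[of e k] Y01[of e k] i that by auto
    moreover have "0 \<le> X k i j \<and> X k i j \<le> X k i None"
      using X4[OF e, of k] that(2) i by (auto simp: ls_cone_AT_bal_iff)
    ultimately show ?thesis by linarith
  qed
  obtain g where g: "strict_mono g" "\<forall>p\<in>?I \<times> ?I. convergent (\<lambda>k. X (g k) (fst p) (snd p))"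
    using finite_pointwise_convergent_subseq[of "?I \<times> ?I" "\<lambda>k p. X k (fst p) (snd p)" 1] b
    by force
  define Z where "Z i j = lim (\<lambda>k. X (g k) i j)" for i j
  have Z: "(\<lambda>k. X (g k) i j) \<longlonglongrightarrow> Z i j" if "i \<in> ?I" "j \<in> ?I" for i j
  proof -
    have "convergent (\<lambda>k. X (g k) i j)"
      using bspec[OF g(2) SigmaI[OF that]] by simp
    then show ?thesis unfolding Z_def convergent_LIMSEQ_iff .
  qed
  define y where "y = (\<lambda>e\<in>?K. Z None (Some e))"
  have Yl: "(\<lambda>k. Y (g k) e) \<longlonglongrightarrow> y e" if "e \<in> ?K" for e
  proof -
    have "(\<lambda>k. X (g k) None (Some e)) \<longlonglongrightarrow> Z None (Some e)" by (rule Z) (use that in auto)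
    moreover have "X (g k) None (Some e) = Y (g k) e" for k using X3[OF that] by blast
    ultimately show ?thesis using that by (simp add: y_def)
  qed
  have cone: "f \<in> ls_cone ?K (AT_bal n)"
    if F: "\<And>k. F k \<in> ls_cone ?K (AT_bal n)" and l: "\<And>i. i \<in> ?I \<Longrightarrow> (\<lambda>k. F k i) \<longlonglongrightarrow> f i" for F f
  proof -
    have s: "(\<lambda>k. \<Sum>e\<in>A. F k (Some e)) \<longlonglongrightarrow> (\<Sum>e\<in>A. f (Some e))" if "A \<subseteq> ?K" for A
      by (rule tendsto_sum) (use l that in auto)
    note F' = F[unfolded ls_cone_AT_bal_iff]
    have n: "(\<lambda>k. F k None) \<longlonglongrightarrow> f None" and e: "\<And>e. e \<in> ?K \<Longrightarrow> (\<lambda>k. F k (Some e)) \<longlonglongrightarrow> f (Some e)"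
      using l by auto
    show ?thesis
      unfolding ls_cone_AT_bal_iff
    proof (intro conjI ballI allI impI)
      show "0 \<le> f None" using F' by (intro LIMSEQ_le_const[OF n]) auto
      show "0 \<le> f (Some a)" if "a \<in> ?K" for a
        using F' that by (intro LIMSEQ_le_const[OF e]) auto
      show "f (Some a) \<le> f None" if "a \<in> ?K" for a
        using F' that by (intro LIMSEQ_le[OF e n]) auto
      show "f None \<le> (\<Sum>e\<in>cut_out n S. f (Some e))" if "S \<noteq> {} \<and> S \<subset> K_verts n" for S
        using F' that by (intro LIMSEQ_le[OF n s]) (auto simp: cut_subset)
      show "f None \<le> (\<Sum>e\<in>cut_in n S. f (Some e))" if "S \<noteq> {} \<and> S \<subset> K_verts n" for S
        using F' that by (intro LIMSEQ_le[OF n s]) (auto simp: cut_subset)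
      show "(\<Sum>e\<in>cut_out n {v}. f (Some e)) = (\<Sum>e\<in>cut_in n {v}. f (Some e))"
        if "v \<in> K_verts n" for v
        using s[of "cut_out n {v}"] s[of "cut_in n {v}"] F' that
        by (auto simp: cut_subset intro: LIMSEQ_unique)
    qed
  qed
  have yN: "y \<in> ?N"
    unfolding LS_N_def mem_Collect_eq
  proof (intro conjI exI[of _ Z] ballI)
    have "0 \<le> y e" "y e \<le> 1" if "e \<in> ?K" for e
      using LIMSEQ_le_const[OF Yl[OF that], of 0] LIMSEQ_le_const2[OF Yl[OF that], of 1] Y01[OF that]
      by auto
    then show "y \<in> ?K \<rightarrow>\<^sub>E {0..1}" by (auto simp: y_def)
    show "Z i j = Z j i" if "i \<in> ?I" "j \<in> ?I" for i j
      using X1 that by (auto simp: Z_def)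
    show "Z None None = 1" by (simp add: Z_def X2)
    show "Z None (Some e) = y e" if "e \<in> ?K" for e using that by (simp add: y_def)
    show "Z (Some e) (Some e) = y e" if "e \<in> ?K" for e
      using that X3 by (simp add: y_def Z_def)
    show "Z (Some e) \<in> ls_cone ?K (AT_bal n)" if "e \<in> ?K" for e
      by (rule cone[of "\<lambda>k. X (g k) (Some e)"]) (use that X4 Z in auto)
    show "(\<lambda>j. Z None j - Z (Some e) j) \<in> ls_cone ?K (AT_bal n)" if "e \<in> ?K" for e
      by (rule cone[of "\<lambda>k j. X (g k) None j - X (g k) (Some e) j"])
         (use that X5 Z in \<open>auto intro!: tendsto_diff\<close>)
  qed
  have "(\<lambda>k. tour_cost n d (Y (g k))) \<longlonglongrightarrow> tour_cost n d y"
    unfolding tour_cost_def by (intro tendsto_sum tendsto_mult_left Yl)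
  moreover have "(\<lambda>k. m + inverse (real (Suc (g k)))) \<longlonglongrightarrow> m"
    using LIMSEQ_subseq_LIMSEQ[OF LIMSEQ_inverse_real_of_nat_add[of m] g(1)] by (simp add: o_def)
  ultimately have "tour_cost n d y \<le> m"
    by (rule LIMSEQ_le) (use Y(2) less_imp_le in blast)
  moreover have "m \<le> tour_cost n d z" if "z \<in> ?N" for z
    unfolding m_def by (rule cINF_lower[OF bdd that])
  ultimately show ?thesis using yN unfolding is_arg_min_def by (meson leD order_trans)
qed

section \<open>Existence of an optimal tour\<close>

lemma finite_AT_int: "finite (AT_int n)"
proof (rule finite_subset)
  show "AT_int n \<subseteq> K_edges n \<rightarrow>\<^sub>E {0, 1}" by (simp add: AT_int_def Collect_restrict)
  show "finite (K_edges n \<rightarrow>\<^sub>E {0, 1 :: real})" by (simp add: finite_PiE)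
qed

text \<open>The witness is the tour through 0, 1, ..., n - 1 and back to 0. A nonempty set closed
  under the successor map \<open>s\<close> contains all vertices, so the tour leaves every proper
  one.\<close>

lemma AT_int_nonempty:
  assumes "n \<ge> 2"
  shows "AT_int n \<noteq> {}"
proof -
  define s where "s u = Suc u mod n" for u
  let ?x = "\<lambda>e\<in>K_edges n. if snd e = s (fst e) then 1 else (0::real)"
  have s: "s u < n" "s u \<noteq> u" if "u < n" for u
    using that assms by (auto simp: s_def mod_Suc)
  have pred: "\<exists>!u. u < n \<and> s u = v" if v: "v < n" for v
  proof (cases v)
    case 0
    then show ?thesis using assms v
      by (intro ex1I[of _ "n - 1"]) (auto simp: s_def mod_Suc split: if_splits)
  next
    case (Suc u)
    then show ?thesis using assms v
      by (intro ex1I[of _ u]) (auto simp: s_def mod_Suc split: if_splits)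
  qed
  have x: "sum ?x F = real (card {e \<in> F. snd e = s (fst e)})" if "F \<subseteq> K_edges n" for F
  proof -
    have fin: "finite F" using that finite_K_edges finite_subset by blast
    have "sum ?x F = (\<Sum>e\<in>F. if snd e = s (fst e) then 1 else 0)"
      by (rule sum.cong) (use that in auto)
    also have "\<dots> = real (card {e \<in> F. snd e = s (fst e)})"
      using fin by (simp add: sum.If_cases Int_def conj_commute)
    finally show ?thesis .
  qed
  have out: "sum ?x (cut_out n S) \<ge> 1" if S: "S \<noteq> {}" "S \<subset> K_verts n" for S
  proof -
    have "\<exists>u\<in>S. s u \<notin> S"
    proof (rule ccontr)
      assume "\<not> ?thesis"
      then have c: "\<And>u. u \<in> S \<Longrightarrow> s u \<in> S" by blast
      obtain u where u: "u \<in> S" using S by blast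
      with S have un: "u < n" by (auto simp: K_verts_def)
      have "(u + j) mod n \<in> S" for j
      proof (induction j)
        case (Suc j)
        from c[OF this] show ?case by (simp add: s_def mod_Suc_eq)
      qed (use u un in simp)
      from this[of "n - u + v" for v] un have "v mod n \<in> S" for v by simp
      then have "K_verts n \<subseteq> S" by (auto simp: K_verts_def) (metis mod_less)
      with S show False by blast
    qed
    then obtain u where u: "u \<in> S" "s u \<notin> S" by blast
    with S have "u < n" by (auto simp: K_verts_def)
    with u s[of u] have "(u, s u) \<in> {e \<in> cut_out n S. snd e = s (fst e)}"
      by (simp add: cut_out_def K_edges_def K_verts_def)
    then have "card {e \<in> cut_out n S. snd e = s (fst e)} > 0"
      by (subst card_gt_0_iff) auto
    then show ?thesis by (subst x[OF cut_subset(1)]) linarith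
  qed
  have inn: "sum ?x (cut_in n S) \<ge> 1" if "S \<noteq> {}" "S \<subset> K_verts n" for S
    unfolding cut_in_eq_cut_out_compl by (rule out) (use that in auto)
  have "sum ?x (cut_out n {v}) = 1" "sum ?x (cut_in n {v}) = 1" if "v \<in> K_verts n" for v
  proof -
    from that have v: "v < n" by (simp add: K_verts_def)
    have "{e \<in> cut_out n {v}. snd e = s (fst e)} = {(v, s v)}"
      using v s[OF v] by (auto simp: cut_out_def K_edges_def K_verts_def)
    then show "sum ?x (cut_out n {v}) = 1" by (subst x[OF cut_subset(1)]) simp
    obtain u where u: "u < n" "s u = v" "\<And>u'. u' < n \<and> s u' = v \<Longrightarrow> u' = u" using pred[OF v] by blast
    have a: "e = (u, v)" if "e \<in> cut_in n {v}" "snd e = s (fst e)" for e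
      using that u(3)[of "fst e"] by (cases e) (auto simp: cut_in_def K_edges_def K_verts_def)
    have b: "(u, v) \<in> cut_in n {v}"
      using v s(2)[OF u(1)] u(1,2) by (auto simp: cut_in_def K_edges_def K_verts_def)
    have "{e \<in> cut_in n {v}. snd e = s (fst e)} = {(u, v)}"
    proof
      show "{e \<in> cut_in n {v}. snd e = s (fst e)} \<subseteq> {(u, v)}" using a by blast
      show "{(u, v)} \<subseteq> {e \<in> cut_in n {v}. snd e = s (fst e)}" using b u(2) by simp
    qed
    then show "sum ?x (cut_in n {v}) = 1" by (subst x[OF cut_subset(2)]) simp
  qed
  then have "?x \<in> AT_int n"
    unfolding AT_int_def using out inn by auto
  then show ?thesis by blast
qed

lemma AT_int_attains_min:
  assumes "n \<ge> 2"
  shows "\<exists>x. is_arg_min (tour_cost n d) (\<lambda>z. z \<in> AT_int n) x"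
  by (rule ex_is_arg_min_if_finite[OF finite_AT_int AT_int_nonempty[OF assms]])

section \<open>From robust trail decompositions to integrality gaps\<close>

text \<open>The interface between the graph and the polyhedral argument: arcs come in balanced
  classes, and deleting any one class keeps the graph strongly connected. Balance and conservation
  are tested against all potentials: indicators recover the vertex conditions, and for rings the
  sums telescope. \<open>T\<close> bounds the cost of the connected circulations that tours
  induce.\<close>

locale gap_instance =
  fixes V :: "'v set" and E :: "('v \<times> 'v) set" and w :: "'v \<times> 'v \<Rightarrow> nat"
    and cls :: "'v \<times> 'v \<Rightarrow> 'c" and T :: int
  assumes finite_V: "finite V" and card_V: "card V \<ge> 2"
    and E_subset: "E \<subseteq> V \<times> V" and no_loop: "\<And>e. e \<in> E \<Longrightarrow> fst e \<noteq> snd e"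
    and w_pos: "\<And>e. e \<in> E \<Longrightarrow> w e \<ge> 1"
    and balanced_class:
      "\<And>c (\<phi> :: 'v \<Rightarrow> real). (\<Sum>e\<in>E. if cls e = c then \<phi> (fst e) - \<phi> (snd e) else 0) = 0"
    and robust: "\<And>c S. S \<noteq> {} \<Longrightarrow> S \<subset> V \<Longrightarrow> \<exists>e\<in>E. cls e \<noteq> c \<and> fst e \<in> S \<and> snd e \<notin> S"
    and circulation_cost: "\<And>z :: 'v \<times> 'v \<Rightarrow> nat.
      (\<And>\<phi> :: 'v \<Rightarrow> int. (\<Sum>e\<in>E. (\<phi> (fst e) - \<phi> (snd e)) * int (z e)) = 0) \<Longrightarrow>
      (\<And>S. S \<noteq> {} \<Longrightarrow> S \<subset> V \<Longrightarrow> \<exists>e\<in>E. z e > 0 \<and> fst e \<in> S \<and> snd e \<notin> S) \<Longrightarrow>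
      T \<le> int (\<Sum>e\<in>E. w e * z e)"
begin

lemma finite_E [simp]: "finite E"
  by (rule finite_subset[OF E_subset finite_cartesian_product[OF finite_V finite_V]])

text \<open>The weighting is \<open>b\<close> on all arcs plus \<open>a - b\<close> on class
  \<open>c\<close>. The first part is a sum over all classes, so both parts vanish.\<close>

lemma balanced_two_weights:
  fixes \<phi> :: "'v \<Rightarrow> real"
  shows "(\<Sum>e\<in>E. (if cls e = c then a else b) * (\<phi> (fst e) - \<phi> (snd e))) = 0"
proof -
  let ?D = "\<lambda>e. \<phi> (fst e) - \<phi> (snd e)"
  have "(\<Sum>e\<in>E. ?D e) = (\<Sum>c\<in>cls ` E. \<Sum>e\<in>{e \<in> E. cls e = c}. ?D e)"
    by (rule sum.group[symmetric]) auto
  also have "\<dots> = 0"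
    using balanced_class[of _ \<phi>] by (simp add: sum.inter_filter)
  finally have all: "(\<Sum>e\<in>E. ?D e) = 0" .
  have "(\<Sum>e\<in>E. (if cls e = c then a else b) * ?D e)
      = (\<Sum>e\<in>E. b * ?D e + (a - b) * (if cls e = c then ?D e else 0))"
    by (rule sum.cong) (auto simp: algebra_simps)
  also have "\<dots> = 0"
    using all balanced_class[of c \<phi>] by (simp add: sum.distrib flip: sum_distrib_left)
  finally show ?thesis .
qed

text \<open>
  Distances are minimum costs of integral flows instead of lengths of shortest walks: flows are
  closed under addition and cross every separating cut, which is all that is needed.
\<close>

definition is_flow :: "'v \<Rightarrow> 'v \<Rightarrow> ('v \<times> 'v \<Rightarrow> nat) \<Rightarrow> bool" where
  "is_flow u v z \<longleftrightarrow>
     (\<forall>\<phi> :: 'v \<Rightarrow> int. (\<Sum>e\<in>E. (\<phi> (fst e) - \<phi> (snd e)) * int (z e)) = \<phi> u - \<phi> v)"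

definition flow_dist :: "'v \<Rightarrow> 'v \<Rightarrow> nat" where
  "flow_dist u v = (LEAST m. \<exists>z. is_flow u v z \<and> m = (\<Sum>e\<in>E. w e * z e))"

lemma is_flow_add: "is_flow u v z \<Longrightarrow> is_flow v t z' \<Longrightarrow> is_flow u t (\<lambda>e. z e + z' e)"
  by (simp add: is_flow_def distrib_left sum.distrib)

lemma is_flow_edge:
  assumes "e \<in> E"
  shows "is_flow (fst e) (snd e) (\<lambda>e'. if e' = e then 1 else 0)"
proof -
  have "(\<Sum>e'\<in>E. (\<phi> (fst e') - \<phi> (snd e')) * int (if e' = e then 1 else 0))
      = (\<Sum>e'\<in>E. if e' = e then \<phi> (fst e) - \<phi> (snd e) else 0)" for \<phi> :: "'v \<Rightarrow> int"
    by (rule sum.cong) auto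
  then show ?thesis using assms by (simp add: is_flow_def)
qed

text \<open>The vertices reached by flows from \<open>u\<close> include \<open>u\<close>. If they
  were not all of \<open>V\<close>, \<open>robust\<close> would give an arc leaving this set, and
  adding it to a flow would reach a new vertex.\<close>

lemma is_flow_exists:
  assumes "u \<in> V" "v \<in> V"
  shows "\<exists>z. is_flow u v z"
proof (rule ccontr)
  assume no: "\<not> ?thesis"
  let ?S = "{x \<in> V. \<exists>z. is_flow u x z}"
  have "is_flow u u (\<lambda>_. 0)" by (simp add: is_flow_def)
  with assms no have S: "?S \<noteq> {}" "?S \<subset> V" by auto
  obtain e where e: "e \<in> E" "fst e \<in> ?S" "snd e \<notin> ?S"
    using robust[OF S, of undefined] by (elim bexE conjE)
  then obtain z where "is_flow u (fst e) z" by blast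
  from is_flow_add[OF this is_flow_edge[OF e(1)]] have "snd e \<in> ?S"
    using e(1) E_subset by auto
  with e show False by blast
qed

lemma flow_dist_le: "is_flow u v z \<Longrightarrow> flow_dist u v \<le> (\<Sum>e\<in>E. w e * z e)"
  unfolding flow_dist_def by (rule Least_le, rule exI[of _ z], rule conjI[OF _ refl])

lemma flow_dist_attained:
  assumes "u \<in> V" "v \<in> V"
  shows "\<exists>z. is_flow u v z \<and> flow_dist u v = (\<Sum>e\<in>E. w e * z e)"
  unfolding flow_dist_def
  by (rule LeastI_ex[of "\<lambda>m. \<exists>z. is_flow u v z \<and> m = (\<Sum>e\<in>E. w e * z e)"])
     (use is_flow_exists[OF assms] in blast)

text \<open>Against the indicator of \<open>S\<close> the flow has net value 1, so some leaving arc
  is used.\<close>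

lemma flow_crosses:
  assumes "is_flow u v z" "u \<in> S" "v \<notin> S"
  shows "\<exists>e\<in>E. z e > 0 \<and> fst e \<in> S \<and> snd e \<notin> S"
proof (rule ccontr)
  assume no: "\<not> ?thesis"
  let ?\<phi> = "\<lambda>x. if x \<in> S then 1 else (0::int)"
  have "(\<Sum>e\<in>E. (?\<phi> (fst e) - ?\<phi> (snd e)) * int (z e)) \<le> 0"
    by (rule sum_nonpos) (use no in auto)
  moreover have "(\<Sum>e\<in>E. (?\<phi> (fst e) - ?\<phi> (snd e)) * int (z e)) = 1"
    using assms(1)[unfolded is_flow_def, rule_format, of ?\<phi>] assms(2,3) by simp
  ultimately show False by linarith
qed

lemma flow_dist_triangle:
  assumes "u \<in> V" "v \<in> V" "t \<in> V"
  shows "flow_dist u t \<le> flow_dist u v + flow_dist v t"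
proof -
  obtain z z' where z: "is_flow u v z" "flow_dist u v = (\<Sum>e\<in>E. w e * z e)"
    and z': "is_flow v t z'" "flow_dist v t = (\<Sum>e\<in>E. w e * z' e)"
    using flow_dist_attained assms by meson
  from flow_dist_le[OF is_flow_add[OF z(1) z'(1)]] z(2) z'(2) show ?thesis
    by (simp add: algebra_simps sum.distrib)
qed

lemma flow_dist_edge_le:
  assumes "e \<in> E"
  shows "flow_dist (fst e) (snd e) \<le> w e"
proof -
  have "(\<Sum>e'\<in>E. w e' * (if e' = e then 1 else 0)) = (\<Sum>e'\<in>E. if e' = e then w e' else 0)"
    by (rule sum.cong) auto
  then show ?thesis using flow_dist_le[OF is_flow_edge[OF assms]] assms by simp
qed

text \<open>Needed later to see that the fractional minimum, the denominator of the ratio, is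
  positive.\<close>

lemma flow_dist_ge_1:
  assumes "u \<in> V" "v \<in> V" "u \<noteq> v"
  shows "flow_dist u v \<ge> 1"
proof -
  obtain z where z: "is_flow u v z" "flow_dist u v = (\<Sum>e\<in>E. w e * z e)"
    using flow_dist_attained assms by blast
  obtain e where e: "e \<in> E" "z e > 0" using flow_crosses[OF z(1), of "{u}"] assms by auto
  then have "1 \<le> w e * z e" using w_pos[of e] by simp
  also have "\<dots> \<le> (\<Sum>e\<in>E. w e * z e)"
    by (rule member_le_sum) (use e in auto)
  finally show ?thesis by (simp add: z)
qed

end

text \<open>Ring vertices are lists, while \<open>K_edges n\<close> lives on the numbers below
  \<open>n\<close>; all data are pulled back along the inverse \<open>h\<close> of the
  relabelling.\<close>

lemma gap_instance_transport:
  assumes "gap_instance V E w cls T" and g: "bij_betw g V V'"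
  defines "h \<equiv> map_prod (inv_into V g) (inv_into V g)"
  shows "gap_instance V' (map_prod g g ` E) (w \<circ> h) (cls \<circ> h) T"
proof -
  interpret gap_instance V E w cls T by fact
  have V': "V' = g ` V" and inj: "inj_on g V" using g by (auto simp: bij_betw_def)
  have h: "h (map_prod g g e) = e" if "e \<in> E" for e
    using that E_subset inj by (cases e) (auto simp: h_def)
  have injE: "inj_on (map_prod g g) E" using h by (rule inj_on_inverseI)
  have s: "(\<Sum>e\<in>map_prod g g ` E. f e) = (\<Sum>e\<in>E. f (map_prod g g e))"
    for f :: "_ \<Rightarrow> 'x::comm_monoid_add"
    using sum.reindex[OF injE] by (simp add: o_def)
  have pre: "\<exists>S0. S0 \<noteq> {} \<and> S0 \<subset> V \<and> S = g ` S0" if "S \<noteq> {}" "S \<subset> V'" for S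
    using that inj unfolding V'
    by (intro exI[of _ "{x \<in> V. g x \<in> S}"]) (auto simp: psubset_eq)
  have mem: "g x \<in> g ` S0 \<longleftrightarrow> x \<in> S0" if "S0 \<subset> V" "x \<in> V" for x S0
    using that inj by (simp add: inj_on_image_mem_iff psubset_imp_subset)
  have EV: "fst e \<in> V" "snd e \<in> V" if "e \<in> E" for e using that E_subset by auto
  show ?thesis
  proof
    show "finite V'" using finite_V V' by simp
    show "card V' \<ge> 2" using card_V bij_betw_same_card[OF g] by simp
    show "map_prod g g ` E \<subseteq> V' \<times> V'" using E_subset V' by auto
    show "fst e \<noteq> snd e" if "e \<in> map_prod g g ` E" for e
    proof -
      from that obtain e0 where e0: "e0 \<in> E" "e = map_prod g g e0" by (rule imageE)
      then show ?thesis using no_loop[OF e0(1)] inj_onD[OF inj _ EV[OF e0(1)]] by (simp only: fst_map_prod snd_map_prod) blast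
    qed
    show "(w \<circ> h) e \<ge> 1" if "e \<in> map_prod g g ` E" for e
      using that h w_pos by auto
    show "(\<Sum>e\<in>map_prod g g ` E. if (cls \<circ> h) e = c then \<phi> (fst e) - \<phi> (snd e) else 0) = 0"
      for c and \<phi> :: "_ \<Rightarrow> real"
    proof -
      have "(\<Sum>e\<in>E. if (cls \<circ> h) (map_prod g g e) = c
          then \<phi> (fst (map_prod g g e)) - \<phi> (snd (map_prod g g e)) else 0) =
        (\<Sum>e\<in>E. if cls e = c then (\<phi> \<circ> g) (fst e) - (\<phi> \<circ> g) (snd e) else 0)"
        by (rule sum.cong) (simp_all add: h)
      then show ?thesis unfolding s using balanced_class[of c "\<phi> \<circ> g"] by simp
    qed
    show "\<exists>e\<in>map_prod g g ` E. (cls \<circ> h) e \<noteq> c \<and> fst e \<in> S \<and> snd e \<notin> S"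
      if S: "S \<noteq> {}" "S \<subset> V'" for c S
    proof -
      obtain S0 where S0: "S0 \<noteq> {}" "S0 \<subset> V" "S = g ` S0"
        using pre[OF S] by (elim exE conjE)
      obtain e where e: "e \<in> E" "cls e \<noteq> c" "fst e \<in> S0" "snd e \<notin> S0"
        using robust[OF S0(1,2), of c] by (elim bexE conjE)
      show ?thesis
        by (rule bexI[of _ "map_prod g g e"]) (use e S0 h[OF e(1)] mem EV[OF e(1)] in auto)
    qed
    show "T \<le> int (\<Sum>e\<in>map_prod g g ` E. (w \<circ> h) e * z e)"
      if bal: "\<And>\<phi> :: _ \<Rightarrow> int. (\<Sum>e\<in>map_prod g g ` E. (\<phi> (fst e) - \<phi> (snd e)) * int (z e)) = 0"
        and cut: "\<And>S. S \<noteq> {} \<Longrightarrow> S \<subset> V' \<Longrightarrow>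
          \<exists>e\<in>map_prod g g ` E. z e > 0 \<and> fst e \<in> S \<and> snd e \<notin> S" for z
    proof -
      have "T \<le> int (\<Sum>e\<in>E. w e * (z \<circ> map_prod g g) e)"
      proof (rule circulation_cost)
        fix \<phi> :: "'a \<Rightarrow> int"
        have "(\<Sum>e\<in>E. (\<phi> (fst e) - \<phi> (snd e)) * int ((z \<circ> map_prod g g) e)) =
          (\<Sum>e\<in>E. (\<phi> (inv_into V g (g (fst e))) - \<phi> (inv_into V g (g (snd e)))) * int (z (map_prod g g e)))"
          by (rule sum.cong) (use EV inj in auto)
        also have "\<dots> = 0"
          using bal[of "\<phi> \<circ> inv_into V g"] unfolding s by simp
        finally show "(\<Sum>e\<in>E. (\<phi> (fst e) - \<phi> (snd e)) * int ((z \<circ> map_prod g g) e)) = 0" .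
      next
        fix S assume S: "S \<noteq> {}" "S \<subset> V"
        have gS: "g ` S \<noteq> {}" "g ` S \<subset> V'"
          using S image_strict_mono[OF inj] by (simp_all add: V')
        obtain e where e: "e \<in> E" "z (map_prod g g e) > 0" "g (fst e) \<in> g ` S" "g (snd e) \<notin> g ` S"
          using cut[OF gS] by fastforce
        then show "\<exists>e\<in>E. 0 < (z \<circ> map_prod g g) e \<and> fst e \<in> S \<and> snd e \<notin> S"
          using mem[OF S(2)] EV[OF e(1)] by (intro bexI[of _ e]) auto
      qed
      also have "(\<Sum>e\<in>E. w e * (z \<circ> map_prod g g) e) = (\<Sum>e\<in>map_prod g g ` E. (w \<circ> h) e * z e)"
        unfolding s by (rule sum.cong) (auto simp: h)
      finally show ?thesis .
    qed
  qed
qed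

text \<open>A point of \<open>LS_N\<close> splits into the row of an edge and the complementary row,
  whose heights add up to 1, and homogeneous cut inequalities add.\<close>

lemma LS_N_cut_ge_1:
  assumes y: "y \<in> LS_N (K_edges n) (AT_bal n)" and S: "S \<noteq> {}" "S \<subset> K_verts n"
  shows "sum y (cut_out n S) \<ge> 1"
proof -
  obtain u v where uv: "u \<in> S" "v \<in> K_verts n" "v \<notin> S" using S by blast
  with S have e: "(u, v) \<in> K_edges n" by (auto simp: K_edges_def)
  obtain X where X: "X None None = (1::real)" "\<forall>e\<in>K_edges n. X None (Some e) = y e"
    "X (Some (u, v)) \<in> ls_cone (K_edges n) (AT_bal n)"
    "(\<lambda>j. X None j - X (Some (u, v)) j) \<in> ls_cone (K_edges n) (AT_bal n)"
    using y e unfolding LS_N_def by blast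
  have "X (Some (u, v)) None \<le> (\<Sum>e\<in>cut_out n S. X (Some (u, v)) (Some e))"
    using X(3) S unfolding ls_cone_AT_bal_iff by blast
  moreover have "1 - X (Some (u, v)) None \<le>
      (\<Sum>e\<in>cut_out n S. X None (Some e) - X (Some (u, v)) (Some e))"
    using X(4) S unfolding ls_cone_AT_bal_iff X(1) by blast
  moreover have "(\<Sum>e\<in>cut_out n S. X None (Some e)) = sum y (cut_out n S)"
    by (rule sum.cong) (use X(2) cut_subset(1) in auto)
  ultimately show ?thesis by (simp add: sum_subtractf)
qed

section \<open>The fractional point and the bound on tours for graphs on numbers\<close>

locale nat_gap_instance = gap_instance "{..<n}" E w cls T
  for n :: nat and E w cls T
begin

lemma E_subset_K: "E \<subseteq> K_edges n"
  using E_subset no_loop by (fastforce simp: K_edges_def K_verts_def)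

text \<open>\<open>robust\<close> is used twice: an arc outside class \<open>c\<close> has value
  \<open>b\<close>, and a second arc, outside the class of the first, has value at least
  \<open>min a b\<close>. So each cut carries at least \<open>b + min a b\<close>. Balance is
  \<open>balanced_two_weights\<close> at the indicator of a vertex.\<close>

lemma two_weights_in_cone:
  assumes ab: "0 \<le> a" "a \<le> l" "0 \<le> b" "b \<le> l" "l \<le> b + min a b"
    and y: "y None = l"
      "\<And>e. e \<in> K_edges n \<Longrightarrow> y (Some e) = (if e \<in> E then if cls e = c then a else b else 0)"
  shows "y \<in> ls_cone (K_edges n) (AT_bal n)"
proof -
  let ?f = "\<lambda>e. if cls e = c then a else b"
  have s: "(\<Sum>e\<in>F. y (Some e)) = (\<Sum>e\<in>F \<inter> E. ?f e)" if F: "F \<subseteq> K_edges n" for F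
  proof -
    have "finite F" using F finite_subset finite_K_edges by blast
    moreover have "(\<Sum>e\<in>F. y (Some e)) = (\<Sum>e\<in>F. if e \<in> E then ?f e else 0)"
      by (rule sum.cong) (use F y(2) in auto)
    ultimately show ?thesis by (simp add: sum.inter_restrict)
  qed
  have out: "l \<le> (\<Sum>e\<in>cut_out n S. y (Some e))" if S: "S \<noteq> {}" "S \<subset> K_verts n" for S
  proof -
    from S(2) have S2: "S \<subset> {..<n}" by (simp add: K_verts_def)
    obtain e1 where e1: "e1 \<in> E" "cls e1 \<noteq> c" "fst e1 \<in> S" "snd e1 \<notin> S"
      using robust[OF S(1) S2] by blast
    obtain e2 where e2: "e2 \<in> E" "cls e2 \<noteq> cls e1" "fst e2 \<in> S" "snd e2 \<notin> S"
      using robust[OF S(1) S2] by blast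
    have "l \<le> (\<Sum>e\<in>{e1, e2}. ?f e)"
      using e1(2) e2(2) ab by (subst sum.insert) (auto split: if_splits)
    also have "\<dots> \<le> (\<Sum>e\<in>cut_out n S \<inter> E. ?f e)"
    proof (rule sum_mono2)
      show "{e1, e2} \<subseteq> cut_out n S \<inter> E"
        using e1 e2 E_subset_K by (auto simp: cut_out_def)
    qed (use ab in auto)
    finally show ?thesis by (simp add: s cut_subset)
  qed
  have inn: "l \<le> (\<Sum>e\<in>cut_in n S. y (Some e))" if "S \<noteq> {}" "S \<subset> K_verts n" for S
    unfolding cut_in_eq_cut_out_compl by (rule out) (use that in auto)
  have bal: "(\<Sum>e\<in>cut_out n {v}. y (Some e)) = (\<Sum>e\<in>cut_in n {v}. y (Some e))" for v
  proof -
    have o: "cut_out n {v} \<inter> E = {e \<in> E. fst e = v}" and i: "cut_in n {v} \<inter> E = {e \<in> E. snd e = v}"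
      using E_subset_K by (auto simp: cut_singleton)
    have "(\<Sum>e\<in>cut_out n {v} \<inter> E. ?f e) - (\<Sum>e\<in>cut_in n {v} \<inter> E. ?f e)
      = (\<Sum>e\<in>E. (if fst e = v then ?f e else 0) - (if snd e = v then ?f e else 0))"
      unfolding o i by (simp add: sum.inter_filter sum_subtractf)
    also have "\<dots> = (\<Sum>e\<in>E. ?f e * (of_bool (fst e = v) - of_bool (snd e = v)))"
      by (rule sum.cong) auto
    also have "\<dots> = 0"
      by (rule balanced_two_weights[of c a b "\<lambda>x. of_bool (x = v)"])
    finally show ?thesis by (simp add: s cut_subset)
  qed
  show ?thesis
    unfolding ls_cone_AT_bal_iff using ab y out inn bal by auto
qed

text \<open>Arcs of one class occur together, arcs of different classes have joint value 1/3. The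
  row of an arc divided by 2/3 is 1 on its class and 1/2 elsewhere; the complementary row divided by
  1/3 is 0 on the class and 1 elsewhere. Both satisfy \<open>l = b + min a b\<close>. For an edge
  outside \<open>E\<close> the row vanishes and the complementary row is the point itself.\<close>

lemma two_thirds_in_LS_N:
  "(\<lambda>e\<in>K_edges n. if e \<in> E then 2/3 else 0) \<in> LS_N (K_edges n) (AT_bal n)"
proof -
  define X :: "(nat \<times> nat) option \<Rightarrow> (nat \<times> nat) option \<Rightarrow> real" where
    "X i j = (case (i, j) of
       (None, None) \<Rightarrow> 1
     | (None, Some e) \<Rightarrow> if e \<in> E then 2/3 else 0
     | (Some e, None) \<Rightarrow> if e \<in> E then 2/3 else 0
     | (Some e, Some f) \<Rightarrow> if e \<in> E \<and> f \<in> E then if cls f = cls e then 2/3 else 1/3 else 0)" for i j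
  show ?thesis
    unfolding LS_N_def mem_Collect_eq
  proof (intro conjI exI[of _ X] ballI)
    show "X i j = X j i" for i j by (auto simp: X_def split: option.splits)
    show "X (Some e) \<in> ls_cone (K_edges n) (AT_bal n)" for e
    proof (cases "e \<in> E")
      case True
      then show ?thesis
        by (intro two_weights_in_cone[of "2/3" "2/3" "1/3" _ "cls e"]) (auto simp: X_def)
    next
      case False
      then show ?thesis by (intro two_weights_in_cone[of 0 0 0]) (auto simp: X_def)
    qed
    show "(\<lambda>j. X None j - X (Some e) j) \<in> ls_cone (K_edges n) (AT_bal n)" for e
    proof (cases "e \<in> E")
      case True
      then show ?thesis
        by (intro two_weights_in_cone[of 0 "1/3" "1/3" _ "cls e"]) (auto simp: X_def)
    next
      case False
      then show ?thesis by (intro two_weights_in_cone[of "2/3" 1 "2/3"]) (auto simp: X_def)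
    qed
  qed (auto simp: X_def)
qed

text \<open>Each tour edge is replaced by a cheapest flow between its ends. The superposition
  \<open>z\<close> is a circulation because every vertex is once a tail and once a head, and it
  crosses each cut that the tour crosses.\<close>

lemma tour_cost_AT_int_ge:
  assumes x: "x \<in> AT_int n"
  shows "real_of_int T \<le> tour_cost n (\<lambda>e. real (flow_dist (fst e) (snd e))) x"
proof -
  define A where "A = {e \<in> K_edges n. x e = 1}"
  have finA: "finite A" by (simp add: A_def)
  have AV: "fst e < n" "snd e < n" if "e \<in> A" for e
    using that by (auto simp: A_def K_edges_def K_verts_def)
  have x01: "x e = of_bool (e \<in> A)" if "e \<in> K_edges n" for e
    using x that by (auto simp: AT_int_def A_def PiE_iff)
  have sx: "sum x F = real (card (F \<inter> A))" if F: "F \<subseteq> K_edges n" for F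
  proof -
    have "finite F" using F finite_subset finite_K_edges by blast
    moreover have "sum x F = (\<Sum>e\<in>F. of_bool (e \<in> A))"
      by (rule sum.cong) (use F x01 in auto)
    ultimately show ?thesis by (simp add: sum.inter_restrict[symmetric] of_bool_def)
  qed
  have deg: "card {e \<in> A. fst e = v} = 1" "card {e \<in> A. snd e = v} = 1" if "v < n" for v
  proof -
    have "sum x (cut_out n {v}) = 1" "sum x (cut_in n {v}) = 1"
      using x that by (auto simp: AT_int_def K_verts_def)
    then have "card (cut_out n {v} \<inter> A) = 1" "card (cut_in n {v} \<inter> A) = 1"
      by (simp_all add: sx cut_subset)
    moreover have "cut_out n {v} \<inter> A = {e \<in> A. fst e = v}" "cut_in n {v} \<inter> A = {e \<in> A. snd e = v}"
      by (auto simp: cut_singleton A_def)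
    ultimately show "card {e \<in> A. fst e = v} = 1" "card {e \<in> A. snd e = v} = 1" by simp_all
  qed
  have Abal: "(\<Sum>e\<in>A. \<phi> (fst e) - \<phi> (snd e)) = 0" for \<phi> :: "nat \<Rightarrow> int"
  proof -
    have "(\<Sum>e\<in>A. \<phi> (fst e)) = (\<Sum>v<n. \<Sum>e\<in>{e \<in> A. fst e = v}. \<phi> (fst e))"
      by (rule sum.group[symmetric]) (use finA AV in auto)
    also have "\<dots> = (\<Sum>v<n. \<Sum>e\<in>{e \<in> A. fst e = v}. \<phi> v)" by simp
    also have "\<dots> = (\<Sum>v<n. \<phi> v)" using deg by simp
    finally have 1: "(\<Sum>e\<in>A. \<phi> (fst e)) = (\<Sum>v<n. \<phi> v)" .
    have "(\<Sum>e\<in>A. \<phi> (snd e)) = (\<Sum>v<n. \<Sum>e\<in>{e \<in> A. snd e = v}. \<phi> (snd e))"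
      by (rule sum.group[symmetric]) (use finA AV in auto)
    also have "\<dots> = (\<Sum>v<n. \<Sum>e\<in>{e \<in> A. snd e = v}. \<phi> v)" by simp
    also have "\<dots> = (\<Sum>v<n. \<phi> v)" using deg by simp
    finally show ?thesis using 1 by (simp add: sum_subtractf)
  qed
  have "\<exists>z. is_flow (fst e) (snd e) z \<and> flow_dist (fst e) (snd e) = (\<Sum>g\<in>E. w g * z g)"
    if "e \<in> A" for e
    using flow_dist_attained AV[OF that] by simp
  then obtain fl where fl: "\<And>e. e \<in> A \<Longrightarrow> is_flow (fst e) (snd e) (fl e)"
    "\<And>e. e \<in> A \<Longrightarrow> flow_dist (fst e) (snd e) = (\<Sum>g\<in>E. w g * fl e g)"
    by metis
  define z where "z g = (\<Sum>e\<in>A. fl e g)" for g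
  have "T \<le> int (\<Sum>g\<in>E. w g * z g)"
  proof (rule circulation_cost)
    fix \<phi> :: "nat \<Rightarrow> int"
    have "(\<Sum>g\<in>E. (\<phi> (fst g) - \<phi> (snd g)) * int (z g))
        = (\<Sum>g\<in>E. \<Sum>e\<in>A. (\<phi> (fst g) - \<phi> (snd g)) * int (fl e g))"
      by (simp add: z_def sum_distrib_left)
    also have "\<dots> = (\<Sum>e\<in>A. \<Sum>g\<in>E. (\<phi> (fst g) - \<phi> (snd g)) * int (fl e g))"
      by (rule sum.swap)
    also have "\<dots> = (\<Sum>e\<in>A. \<phi> (fst e) - \<phi> (snd e))"
      by (rule sum.cong) (use fl(1) in \<open>auto simp: is_flow_def\<close>)
    finally show "(\<Sum>g\<in>E. (\<phi> (fst g) - \<phi> (snd g)) * int (z g)) = 0" using Abal by simp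
  next
    fix S assume S: "S \<noteq> {}" "S \<subset> {..<n}"
    then have "sum x (cut_out n S) \<ge> 1" using x by (auto simp: AT_int_def K_verts_def)
    then have "cut_out n S \<inter> A \<noteq> {}" by (auto simp: sx cut_subset)
    then obtain e where e: "e \<in> A" "fst e \<in> S" "snd e \<notin> S" by (auto simp: cut_out_def)
    obtain g where g: "g \<in> E" "fl e g > 0" "fst g \<in> S" "snd g \<notin> S"
      using flow_crosses[OF fl(1)[OF e(1)] e(2,3)] by blast
    have "fl e g \<le> z g" unfolding z_def by (rule member_le_sum) (use e finA in auto)
    with g show "\<exists>g\<in>E. 0 < z g \<and> fst g \<in> S \<and> snd g \<notin> S" by (intro bexI[of _ g]) auto
  qed
  also have "(\<Sum>g\<in>E. w g * z g) = (\<Sum>g\<in>E. \<Sum>e\<in>A. w g * fl e g)"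
    by (simp add: z_def sum_distrib_left)
  also have "\<dots> = (\<Sum>e\<in>A. \<Sum>g\<in>E. w g * fl e g)"
    by (rule sum.swap)
  also have "\<dots> = (\<Sum>e\<in>A. flow_dist (fst e) (snd e))"
    by (rule sum.cong) (auto simp: fl(2))
  finally have "real_of_int T \<le> (\<Sum>e\<in>A. real (flow_dist (fst e) (snd e)))"
    by (metis of_int_le_iff of_int_of_nat_eq of_nat_sum)
  also have "\<dots> = (\<Sum>e\<in>K_edges n. if e \<in> A then real (flow_dist (fst e) (snd e)) else 0)"
    by (simp add: A_def sum.inter_filter)
  also have "\<dots> = tour_cost n (\<lambda>e. real (flow_dist (fst e) (snd e))) x"
    unfolding tour_cost_def by (rule sum.cong) (auto simp: x01)
  finally show ?thesis .
qed

text \<open>The fractional point costs at most 2/3 of the total weight, since distances of arcs are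
  at most their weights, while tours cost at least \<open>T\<close>.\<close>

lemma integrality_gap:
  "\<exists>d :: nat \<times> nat \<Rightarrow> real.
    (\<forall>e\<in>K_edges n. d e \<ge> 0) \<and>
    (\<forall>u\<in>K_verts n. \<forall>v\<in>K_verts n. \<forall>t\<in>K_verts n.
       u \<noteq> v \<and> v \<noteq> t \<and> u \<noteq> t \<longrightarrow> d (u, t) \<le> d (u, v) + d (v, t)) \<and>
    (\<exists>x y. is_arg_min (tour_cost n d) (\<lambda>z. z \<in> AT_int n) x \<and>
           is_arg_min (tour_cost n d) (\<lambda>z. z \<in> LS_N (K_edges n) (AT_bal n)) y \<and>
           tour_cost n d y > 0 \<and>
           tour_cost n d x / tour_cost n d y \<ge> 3 / 2 * (real_of_int T / real (\<Sum>e\<in>E. w e)))"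
proof -
  let ?d = "\<lambda>e. real (flow_dist (fst e) (snd e))"
  let ?N = "LS_N (K_edges n) (AT_bal n)"
  let ?y = "\<lambda>e\<in>K_edges n. if e \<in> E then 2/3 else (0::real)"
  let ?W = "real (\<Sum>e\<in>E. w e)"
  have n: "n \<ge> 2" using card_V by simp
  obtain x where x: "is_arg_min (tour_cost n ?d) (\<lambda>z. z \<in> AT_int n) x"
    using AT_int_attains_min[OF n] by blast
  obtain y where y: "is_arg_min (tour_cost n ?d) (\<lambda>z. z \<in> ?N) y"
    using LS_N_attains_min two_thirds_in_LS_N by blast
  have yN: "y \<in> ?N" and xI: "x \<in> AT_int n" using x y by (simp_all add: is_arg_min_def)
  \<comment> \<open>The cut around vertex 0 gives total value at least 1, and every distance is at
    least 1, so the fractional minimum is positive.\<close>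
  have "1 \<le> sum y (cut_out n {0})"
  proof (rule LS_N_cut_ge_1[OF yN])
    have "0 \<in> K_verts n" "1 \<in> K_verts n" using n by (auto simp: K_verts_def)
    then show "{0} \<subset> K_verts n" by auto
  qed simp
  also have "\<dots> \<le> sum y (K_edges n)"
    by (rule sum_mono2) (use yN cut_subset in \<open>auto simp: LS_N_def PiE_iff\<close>)
  also have "\<dots> \<le> tour_cost n ?d y"
    unfolding tour_cost_def
  proof (rule sum_mono)
    fix e assume e: "e \<in> K_edges n"
    then have "?d e \<ge> 1" using flow_dist_ge_1[of "fst e" "snd e"]
      by (auto simp: K_edges_def K_verts_def)
    moreover have "y e \<ge> 0" using yN e by (auto simp: LS_N_def PiE_iff)
    ultimately show "y e \<le> ?d e * y e" using mult_right_mono[of 1 "?d e" "y e"] by simp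
  qed
  finally have pos: "tour_cost n ?d y > 0" by simp
  have "tour_cost n ?d y \<le> tour_cost n ?d ?y"
    using y two_thirds_in_LS_N by (auto simp: is_arg_min_linorder)
  also have "\<dots> = (\<Sum>e\<in>K_edges n. if e \<in> E then 2/3 * ?d e else 0)"
    unfolding tour_cost_def by (rule sum.cong) auto
  also have "\<dots> = (\<Sum>e\<in>E. 2/3 * ?d e)"
    using E_subset_K by (simp add: sum.inter_restrict[symmetric] Int_absorb1)
  also have "\<dots> \<le> (\<Sum>e\<in>E. 2/3 * real (w e))"
    by (rule sum_mono) (use flow_dist_edge_le in simp)
  finally have yW: "tour_cost n ?d y \<le> 2/3 * ?W" by (simp add: sum_distrib_left)
  have x0: "tour_cost n ?d x \<ge> 0"
    unfolding tour_cost_def by (rule sum_nonneg) (use xI in \<open>force simp: AT_int_def PiE_iff\<close>)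
  have "3 / 2 * (real_of_int T / ?W) = real_of_int T / (2/3 * ?W)" by simp
  also have "\<dots> \<le> tour_cost n ?d x / (2/3 * ?W)"
    by (rule divide_right_mono[OF tour_cost_AT_int_ge[OF xI]]) (simp add: sum_nonneg)
  also have "\<dots> \<le> tour_cost n ?d x / tour_cost n ?d y"
    by (rule divide_left_mono[OF yW x0]) (use pos yW in \<open>simp add: zero_less_mult_iff\<close>)
  finally have "tour_cost n ?d x / tour_cost n ?d y \<ge> 3 / 2 * (real_of_int T / ?W)" .
  moreover have "?d (u, t) \<le> ?d (u, v) + ?d (v, t)"
    if "u \<in> K_verts n" "v \<in> K_verts n" "t \<in> K_verts n" for u v t
    using flow_dist_triangle[of u v t] that by (simp add: K_verts_def flip: of_nat_add)
  ultimately show ?thesis using x y pos by (intro exI[of _ ?d]) auto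
qed

end

section \<open>Ring graphs\<close>

text \<open>Vertices are addresses: at level \<open>Suc k\<close> the first number is a position, 0
  and \<open>Suc r\<close> being the terminals, and the rest is a vertex of the copy at that
  position. The ring of level 0 is a single vertex, entry and exit at once.\<close>

fun entry :: "nat \<Rightarrow> nat list" where
  "entry 0 = []"
| "entry (Suc k) = [0]"

fun exit :: "nat \<Rightarrow> nat \<Rightarrow> nat list" where
  "exit r 0 = []"
| "exit r (Suc k) = [Suc r]"

text \<open>Counting the terminals as positions lets one formula describe all arcs of a
  path.\<close>

definition fwd_stop :: "nat \<Rightarrow> nat \<Rightarrow> nat \<Rightarrow> nat list" where
  "fwd_stop r k i = (if i = 0 \<or> i = Suc r then [i] else i # entry k)"

definition bwd_stop :: "nat \<Rightarrow> nat \<Rightarrow> nat \<Rightarrow> nat list" where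
  "bwd_stop r k i = (if i = 0 \<or> i = Suc r then [i] else i # exit r k)"

definition fwd_arc :: "nat \<Rightarrow> nat \<Rightarrow> nat \<Rightarrow> nat list \<times> nat list" where
  "fwd_arc r k i = (fwd_stop r k i, fwd_stop r k (Suc i))"

definition bwd_arc :: "nat \<Rightarrow> nat \<Rightarrow> nat \<Rightarrow> nat list \<times> nat list" where
  "bwd_arc r k i = (bwd_stop r k (Suc i), bwd_stop r k i)"

definition lift :: "nat \<Rightarrow> nat list \<times> nat list \<Rightarrow> nat list \<times> nat list" where
  "lift i e = (i # fst e, i # snd e)"

fun verts :: "nat \<Rightarrow> nat \<Rightarrow> nat list set" where
  "verts r 0 = {[]}"
| "verts r (Suc k) = {[0], [Suc r]} \<union> (\<Union>i\<in>{1..r}. (#) i ` verts r k)"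

fun arcs :: "nat \<Rightarrow> nat \<Rightarrow> (nat list \<times> nat list) set" where
  "arcs r 0 = {}"
| "arcs r (Suc k) = fwd_arc r k ` {..r} \<union> bwd_arc r k ` {..r} \<union> (\<Union>i\<in>{1..r}. lift i ` arcs r k)"

text \<open>Equal first numbers mark an arc inside a copy. The value 1 at level 0, which has no
  arcs, lets positivity hold for arbitrary arguments.\<close>

fun wt :: "nat \<Rightarrow> nat \<Rightarrow> nat list \<times> nat list \<Rightarrow> nat" where
  "wt r 0 e = 1"
| "wt r (Suc k) e =
     (if hd (fst e) = hd (snd e) then wt r k (tl (fst e), tl (snd e)) else r ^ k)"

text \<open>
  The label of the closed trail through an arc of the ring of level \<open>2 * j\<close>. Trail \<open>[i]\<close> consists of
  the two outermost arcs between the copies \<open>i\<close> and \<open>i + 1\<close>, the forward path of copy \<open>i + 1\<close> and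
  the backward path of copy \<open>i\<close>; the arcs two levels down are treated recursively.
\<close>

fun trail :: "nat \<Rightarrow> nat list \<times> nat list \<Rightarrow> nat list" where
  "trail 0 e = []"
| "trail (Suc j) (u, v) =
     (if hd u \<noteq> hd v then [min (hd u) (hd v)]
      else if hd (tl u) < hd (tl v) then [hd u - 1]
      else if hd (tl u) > hd (tl v) then [hd u]
      else hd u # hd (tl u) # trail j (tl (tl u), tl (tl v)))"

section \<open>Basic facts on ring graphs\<close>

lemma hd_stop [simp]: "hd (fwd_stop r k i) = i" "hd (bwd_stop r k i) = i"
  by (simp_all add: fwd_stop_def bwd_stop_def)

lemma stop_ends [simp]:
  "fwd_stop r k 0 = [0]" "bwd_stop r k 0 = [0]"
  "fwd_stop r k (Suc r) = [Suc r]" "bwd_stop r k (Suc r) = [Suc r]"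
  by (simp_all add: fwd_stop_def bwd_stop_def)

lemma stop_inner:
  "1 \<le> i \<Longrightarrow> i \<le> r \<Longrightarrow> fwd_stop r k i = i # entry k"
  "1 \<le> i \<Longrightarrow> i \<le> r \<Longrightarrow> bwd_stop r k i = i # exit r k"
  by (simp_all add: fwd_stop_def bwd_stop_def)

lemma arc_ends [simp]:
  "fst (fwd_arc r k i) = fwd_stop r k i" "snd (fwd_arc r k i) = fwd_stop r k (Suc i)"
  "fst (bwd_arc r k i) = bwd_stop r k (Suc i)" "snd (bwd_arc r k i) = bwd_stop r k i"
  "fst (lift i e) = i # fst e" "snd (lift i e) = i # snd e"
  by (simp_all add: fwd_arc_def bwd_arc_def lift_def)

lemma trail_simps:
  "trail (Suc j) (fwd_arc r k i) = [i]"
  "trail (Suc j) (bwd_arc r k i) = [i]"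
  "trail (Suc j) (lift i (fwd_arc r k l)) = [i - 1]"
  "trail (Suc j) (lift i (bwd_arc r k l)) = [i]"
  "trail (Suc j) (lift i (lift l e)) = i # l # trail j e"
  by (simp_all add: fwd_arc_def bwd_arc_def lift_def)

lemma entry_exit_in_verts: "entry k \<in> verts r k" "exit r k \<in> verts r k"
  by (cases k; simp)+

lemma Cons_in_verts: "1 \<le> i \<Longrightarrow> i \<le> r \<Longrightarrow> u \<in> verts r k \<Longrightarrow> i # u \<in> verts r (Suc k)"
  unfolding verts.simps by (rule UnI2, rule UN_I[of i]) auto

lemma stop_in_verts:
  assumes "i \<le> Suc r"
  shows "fwd_stop r k i \<in> verts r (Suc k)" "bwd_stop r k i \<in> verts r (Suc k)"
proof -
  have "i = 0 \<or> i = Suc r \<or> (1 \<le> i \<and> i \<le> r)" using assms by linarith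
  then show "fwd_stop r k i \<in> verts r (Suc k)" "bwd_stop r k i \<in> verts r (Suc k)"
    using Cons_in_verts[OF _ _ entry_exit_in_verts(1)] Cons_in_verts[OF _ _ entry_exit_in_verts(2)]
    by (auto simp: stop_inner simp del: verts.simps) auto
qed

lemma verts_Suc_cases:
  assumes "v \<in> verts r (Suc k)"
  obtains "v = [0]" | "v = [Suc r]" | i u where "1 \<le> i" "i \<le> r" "u \<in> verts r k" "v = i # u"
  using assms by auto

lemma finite_verts: "finite (verts r k)"
  by (induction k) auto

lemma finite_arcs [simp]: "finite (arcs r k)"
  by (induction k) auto

lemma arcs_subset: "arcs r k \<subseteq> verts r k \<times> verts r k"
proof (induction k)
  case (Suc k)
  show ?case
  proof
    fix e assume "e \<in> arcs r (Suc k)"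
    then consider i where "i \<le> r" "e = fwd_arc r k i" | i where "i \<le> r" "e = bwd_arc r k i"
      | i e' where "1 \<le> i" "i \<le> r" "e' \<in> arcs r k" "e = lift i e'"
      by auto
    then show "e \<in> verts r (Suc k) \<times> verts r (Suc k)"
    proof cases
      case 3
      with Suc have "fst e' \<in> verts r k" "snd e' \<in> verts r k" by auto
      with 3 show ?thesis by (auto simp: lift_def)
    qed (use stop_in_verts in \<open>simp_all add: fwd_arc_def bwd_arc_def del: verts.simps\<close>)
  qed
qed simp

lemma arcs_no_loop: "e \<in> arcs r k \<Longrightarrow> fst e \<noteq> snd e"
proof (induction k arbitrary: e)
  case (Suc k)
  then show ?case by (auto dest: arg_cong[of _ _ hd])
qed simp

lemma sum_arcs_Suc:
  fixes f :: "nat list \<times> nat list \<Rightarrow> 'a :: comm_monoid_add"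
  shows "(\<Sum>e\<in>arcs r (Suc k). f e) = (\<Sum>i\<le>r. f (fwd_arc r k i)) + (\<Sum>i\<le>r. f (bwd_arc r k i))
    + (\<Sum>i=1..r. \<Sum>e\<in>arcs r k. f (lift i e))"
proof -
  \<comment> \<open>The first numbers of the two ends tell the families apart: they go up by one, go
    down by one, or agree.\<close>
  let ?h = "\<lambda>e. (hd (fst e), hd (snd e))"
  have h: "?h (fwd_arc r k i) = (i, Suc i)" "?h (bwd_arc r k i) = (Suc i, i)" "?h (lift i e) = (i, i)"
    for i e by simp_all
  let ?F = "fwd_arc r k ` {..r}" and ?B = "bwd_arc r k ` {..r}"
    and ?C = "\<Union>i\<in>{1..r}. lift i ` arcs r k"
  have "?F \<inter> ?B = {}"
  proof -
    have "fwd_arc r k i \<noteq> bwd_arc r k l" for i l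
      using h(1)[of i] h(2)[of l] by (metis Suc_n_not_le_n le_SucI order_refl prod.inject)
    then show ?thesis by blast
  qed
  moreover have "(?F \<union> ?B) \<inter> ?C = {}"
  proof -
    have "fwd_arc r k i \<noteq> lift l e" "bwd_arc r k i \<noteq> lift l e" for i l e
      using h(1)[of i] h(2)[of i] h(3)[of l e] by (metis n_not_Suc_n prod.inject)+
    then show ?thesis by blast
  qed
  ultimately have "(\<Sum>e\<in>arcs r (Suc k). f e) = sum f ?F + sum f ?B + sum f ?C"
    by (simp add: sum.union_disjoint)
  moreover have "sum f ?F = (\<Sum>i\<le>r. f (fwd_arc r k i))"
    by (subst sum.reindex) (auto simp: inj_on_def dest: arg_cong[of _ _ ?h])
  moreover have "sum f ?B = (\<Sum>i\<le>r. f (bwd_arc r k i))"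
    by (subst sum.reindex) (auto simp: inj_on_def dest: arg_cong[of _ _ ?h])
  moreover have "sum f ?C = (\<Sum>i=1..r. \<Sum>e\<in>arcs r k. f (lift i e))"
  proof -
    have "lift i ` arcs r k \<inter> lift l ` arcs r k = {}" if "i \<noteq> l" for i l
      using that by (auto simp: lift_def)
    then have "sum f ?C = (\<Sum>i=1..r. sum f (lift i ` arcs r k))"
      by (subst sum.UNION_disjoint) auto
    also have "\<dots> = (\<Sum>i=1..r. \<Sum>e\<in>arcs r k. f (lift i e))"
      by (rule sum.cong[OF refl], subst sum.reindex) (auto simp: inj_on_def lift_def)
    finally show ?thesis .
  qed
  ultimately show ?thesis by simp
qed

text \<open>In trail \<open>[i]\<close> the outer arcs contribute \<open>D i - D (Suc i)\<close>,
  the forward path of copy \<open>Suc i\<close> contributes \<open>D (Suc i)\<close> and the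
  backward path of copy \<open>i\<close> contributes \<open>- D i\<close>. At a terminal both stops
  coincide, so \<open>D\<close> vanishes there and no copy is missed. Arcs two levels down are
  covered by induction.\<close>

lemma trail_balanced:
  fixes \<phi> :: "nat list \<Rightarrow> 'a :: ab_group_add"
  shows "(\<Sum>e\<in>arcs r (2 * j). if trail j e = c then \<phi> (fst e) - \<phi> (snd e) else 0) = 0"
proof (induction j arbitrary: c \<phi>)
  case (Suc j)
  let ?k = "2 * j"
  define D where "D i = \<phi> (fwd_stop r (Suc ?k) i) - \<phi> (bwd_stop r (Suc ?k) i)" for i
  \<comment> \<open>The contribution \<open>x\<close> of trail \<open>[i]\<close>, counted only if
    that trail is \<open>c\<close>.\<close>
  define \<delta> where "\<delta> i x = (if c = [i] then x else (0 :: 'a))" for i x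
  have \<delta>: "\<delta> i (x - y) = \<delta> i x - \<delta> i y" for i x y by (simp add: \<delta>_def)
  have tele: "(\<Sum>l\<le>r. g l - g (Suc l)) = g 0 - g (Suc r)" for g :: "nat \<Rightarrow> 'a"
    by (induction r) auto
  have D0: "D 0 = 0" "D (Suc r) = 0" by (simp_all add: D_def)
  have copy: "(\<Sum>e\<in>arcs r (Suc ?k). if trail (Suc j) (lift i e) = c
        then \<phi> (fst (lift i e)) - \<phi> (snd (lift i e)) else 0) = \<delta> (i - 1) (D i) - \<delta> i (D i)"
    if i: "i \<in> {1..r}" for i
  proof -
    have "(\<Sum>l\<le>r. if [i - 1] = c then \<phi> (i # fwd_stop r ?k l) - \<phi> (i # fwd_stop r ?k (Suc l)) else 0)
        = \<delta> (i - 1) (D i)"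
      using i tele[of "\<lambda>l. \<phi> (i # fwd_stop r ?k l)"] by (auto simp: \<delta>_def D_def stop_inner)
    moreover have
      "(\<Sum>l\<le>r. if [i] = c then \<phi> (i # bwd_stop r ?k (Suc l)) - \<phi> (i # bwd_stop r ?k l) else 0)
        = - \<delta> i (D i)"
      using i tele[of "\<lambda>l. - \<phi> (i # bwd_stop r ?k l)"] by (auto simp: \<delta>_def D_def stop_inner)
    moreover have "(\<Sum>e\<in>arcs r ?k. if i # l # trail j e = c
        then \<phi> (i # l # fst e) - \<phi> (i # l # snd e) else 0) = 0" for l
    proof (cases "\<exists>c'. c = i # l # c'")
      case True
      then obtain c' where "c = i # l # c'" by blast
      then show ?thesis using Suc.IH[of c' "\<lambda>v. \<phi> (i # l # v)"] by simp
    next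
      case False
      then have "(if i # l # trail j e = c then \<phi> (i # l # fst e) - \<phi> (i # l # snd e) else 0) = 0" for e
        by auto
      then show ?thesis by simp
    qed
    ultimately show ?thesis
      by (subst sum_arcs_Suc) (simp only: trail_simps arc_ends sum.neutral_const add_0_right, simp)
  qed
  have "(\<Sum>e\<in>arcs r (2 * Suc j). if trail (Suc j) e = c then \<phi> (fst e) - \<phi> (snd e) else 0)
      = (\<Sum>i\<le>r. \<delta> i (D i) - \<delta> i (D (Suc i))) + (\<Sum>i=1..r. \<delta> (i - 1) (D i) - \<delta> i (D i))"
  proof -
    have "(\<Sum>i\<le>r. if [i] = c
          then \<phi> (fwd_stop r (Suc ?k) i) - \<phi> (fwd_stop r (Suc ?k) (Suc i)) else 0)
        + (\<Sum>i\<le>r. if [i] = c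
          then \<phi> (bwd_stop r (Suc ?k) (Suc i)) - \<phi> (bwd_stop r (Suc ?k) i) else 0)
        = (\<Sum>i\<le>r. \<delta> i (D i) - \<delta> i (D (Suc i)))"
      by (subst sum.distrib[symmetric], rule sum.cong) (auto simp: \<delta>_def D_def)
    moreover have "(\<Sum>i=1..r. \<Sum>e\<in>arcs r (Suc ?k). if trail (Suc j) (lift i e) = c
        then \<phi> (fst (lift i e)) - \<phi> (snd (lift i e)) else 0)
        = (\<Sum>i=1..r. \<delta> (i - 1) (D i) - \<delta> i (D i))"
      by (rule sum.cong[OF refl copy])
    moreover have "2 * Suc j = Suc (Suc ?k)" by simp
    ultimately show ?thesis
      by (simp only: sum_arcs_Suc[of _ r "Suc ?k"] trail_simps arc_ends)
  qed
  also have "\<dots> = 0"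
  proof -
    have "(\<Sum>i\<le>r. \<delta> i (D i)) = \<delta> 0 (D 0) + (\<Sum>i=1..r. \<delta> i (D i))"
      using sum.atLeast_Suc_atMost[of 0 r "\<lambda>i. \<delta> i (D i)"] by (simp add: atMost_atLeast0)
    moreover have "(\<Sum>i\<le>r. \<delta> i (D (Suc i))) = (\<Sum>i=1..Suc r. \<delta> (i - 1) (D i))"
      using sum.shift_bounds_cl_Suc_ivl[of "\<lambda>i. \<delta> (i - 1) (D i)" 0 r] by (simp add: atMost_atLeast0)
    moreover have "\<delta> i 0 = 0" for i by (simp add: \<delta>_def)
    ultimately show ?thesis using D0 by (simp add: sum_subtractf)
  qed
  finally show ?case .
qed simp

section \<open>Removing a trail keeps a ring connected\<close>

text \<open>Strong connectivity is phrased as follows: a nonempty vertex set closed under the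
  remaining arcs is everything. These predicates record which arcs remain.\<close>

definition fwd_closed :: "nat \<Rightarrow> nat \<Rightarrow> nat list set \<Rightarrow> bool" where
  "fwd_closed r k S \<longleftrightarrow> (\<forall>i\<le>r. fwd_stop r k i \<in> S \<longrightarrow> fwd_stop r k (Suc i) \<in> S)"

definition bwd_closed :: "nat \<Rightarrow> nat \<Rightarrow> nat list set \<Rightarrow> bool" where
  "bwd_closed r k S \<longleftrightarrow> (\<forall>i\<le>r. bwd_stop r k (Suc i) \<in> S \<longrightarrow> bwd_stop r k i \<in> S)"

definition copies_full :: "nat \<Rightarrow> nat \<Rightarrow> nat list set \<Rightarrow> bool" where
  "copies_full r k S \<longleftrightarrow>
     (\<forall>i\<in>{1..r}. (\<exists>v\<in>verts r k. i # v \<in> S) \<longrightarrow> (\<forall>v\<in>verts r k. i # v \<in> S))"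

lemma fwd_stop_up:
  assumes "fwd_closed r k S" "fwd_stop r k i \<in> S" "i \<le> l" "l \<le> Suc r"
  shows "fwd_stop r k l \<in> S"
  using assms(3,2,4) by (induction rule: dec_induct) (use assms(1) in \<open>auto simp: fwd_closed_def\<close>)

lemma bwd_stop_down:
  assumes "bwd_closed r k S" "bwd_stop r k l \<in> S" "i \<le> l" "l \<le> Suc r"
  shows "bwd_stop r k i \<in> S"
  using assms(3,2,4) by (induction rule: inc_induct) (use assms(1) in \<open>auto simp: bwd_closed_def\<close>)

lemma copies_full_stops:
  assumes "copies_full r k S" "v \<in> verts r (Suc k)" "v \<in> S"
  shows "\<exists>i\<le>Suc r. fwd_stop r k i \<in> S \<and> bwd_stop r k i \<in> S"
  using assms(2)
proof (cases rule: verts_Suc_cases)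
  case (3 i u)
  with assms(1,3) have "\<forall>v\<in>verts r k. i # v \<in> S" by (auto simp: copies_full_def)
  with 3 show ?thesis
    by (intro exI[of _ i]) (simp add: stop_inner entry_exit_in_verts)
next
  case 1
  with assms(3) show ?thesis by (intro exI[of _ 0]) simp
next
  case 2
  with assms(3) show ?thesis by (intro exI[of _ "Suc r"]) simp
qed

lemma copies_full_subset:
  assumes "copies_full r k S"
    and "\<And>i. i \<le> Suc r \<Longrightarrow> fwd_stop r k i \<in> S \<or> bwd_stop r k i \<in> S"
  shows "verts r (Suc k) \<subseteq> S"
proof
  fix v assume "v \<in> verts r (Suc k)"
  then show "v \<in> S"
  proof (cases rule: verts_Suc_cases)
    case (3 i u)
    have "\<exists>v\<in>verts r k. i # v \<in> S"
      using assms(2)[of i] 3 entry_exit_in_verts by (auto simp: stop_inner)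
    with 3 assms(1) show ?thesis by (auto simp: copies_full_def)
  qed (use assms(2)[of 0] assms(2)[of "Suc r"] in auto)
qed

text \<open>This and the next three lemmas use a single path, as is left in a copy that lost the
  other one: the forward path leads from anywhere to the exit and from the entry to everywhere, the
  backward path the other way round.\<close>

lemma fwd_reaches_exit:
  assumes "fwd_closed r k S" "copies_full r k S" "v \<in> verts r (Suc k)" "v \<in> S"
  shows "[Suc r] \<in> S"
  using copies_full_stops[OF assms(2-4)] fwd_stop_up[OF assms(1), of _ "Suc r"] by auto

lemma bwd_reaches_entry:
  assumes "bwd_closed r k S" "copies_full r k S" "v \<in> verts r (Suc k)" "v \<in> S"
  shows "[0] \<in> S"
  using copies_full_stops[OF assms(2-4)] bwd_stop_down[OF assms(1), of _ 0] by auto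

lemma fwd_from_entry:
  assumes "fwd_closed r k S" "copies_full r k S" "[0] \<in> S"
  shows "verts r (Suc k) \<subseteq> S"
  using fwd_stop_up[OF assms(1), of 0] assms(3) by (intro copies_full_subset[OF assms(2)]) auto

lemma bwd_from_exit:
  assumes "bwd_closed r k S" "copies_full r k S" "[Suc r] \<in> S"
  shows "verts r (Suc k) \<subseteq> S"
  using bwd_stop_down[OF assms(1), of "Suc r"] assms(3)
  by (intro copies_full_subset[OF assms(2)]) auto

lemma ring_full:
  assumes "fwd_closed r k S" "bwd_closed r k S" "copies_full r k S"
    and "v \<in> verts r (Suc k)" "v \<in> S"
  shows "verts r (Suc k) \<subseteq> S"
  using bwd_from_exit[OF assms(2,3) fwd_reaches_exit[OF assms(1,3,4,5)]] .

text \<open>Continue to a terminal on one path and return on the other; the insides of the copies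
  are avoided. So a damaged copy still has its entry and exit tied together by the ring around
  it.\<close>

lemma ring_stops_iff:
  assumes "fwd_closed r k S" "bwd_closed r k S" "i \<le> Suc r"
  shows "fwd_stop r k i \<in> S \<longleftrightarrow> bwd_stop r k i \<in> S"
proof
  assume "fwd_stop r k i \<in> S"
  then have "fwd_stop r k (Suc r) \<in> S" using fwd_stop_up assms by blast
  then show "bwd_stop r k i \<in> S" using bwd_stop_down[OF assms(2), of "Suc r"] assms(3) by simp
next
  assume "bwd_stop r k i \<in> S"
  then have "bwd_stop r k 0 \<in> S" using bwd_stop_down assms by blast
  then show "fwd_stop r k i \<in> S" using fwd_stop_up[OF assms(1), of 0] assms(3) by simp
qed

lemma arcs_SucI:
  "i \<le> r \<Longrightarrow> fwd_arc r k i \<in> arcs r (Suc k)"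
  "i \<le> r \<Longrightarrow> bwd_arc r k i \<in> arcs r (Suc k)"
  "1 \<le> i \<Longrightarrow> i \<le> r \<Longrightarrow> e \<in> arcs r k \<Longrightarrow> lift i e \<in> arcs r (Suc k)"
  by auto

lemma arcs_connected:
  assumes "\<And>e. e \<in> arcs r k \<Longrightarrow> fst e \<in> S \<Longrightarrow> snd e \<in> S" "v \<in> verts r k" "v \<in> S"
  shows "verts r k \<subseteq> S"
  using assms
proof (induction k arbitrary: S v)
  case (Suc k)
  note closed = Suc.prems(1)
  show ?case
  proof (rule ring_full[OF _ _ _ Suc.prems(2,3)])
    show "fwd_closed r k S" unfolding fwd_closed_def
      using closed[OF arcs_SucI(1)] by simp
    show "bwd_closed r k S" unfolding bwd_closed_def
      using closed[OF arcs_SucI(2)] by simp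
    show "copies_full r k S"
      unfolding copies_full_def
    proof (intro ballI impI)
      fix i v assume i: "i \<in> {1..r}" and "\<exists>v\<in>verts r k. i # v \<in> S" and v: "v \<in> verts r k"
      then obtain u where u: "u \<in> verts r k" "i # u \<in> S" by blast
      have "verts r k \<subseteq> {v. i # v \<in> S}"
        by (rule Suc.IH[OF _ u(1)]) (use closed[OF arcs_SucI(3)] i u in auto)
      with v show "i # v \<in> S" by blast
    qed
  qed
qed simp

text \<open>On its own a ring may fall apart: removing trail \<open>[0]\<close> isolates the entry.
  The hypothesis on entry and exit stands for a connection outside the ring, provided by the closing
  arcs at the top and by \<open>ring_stops_iff\<close> further down.\<close>

lemma arcs_robust:
  assumes "\<And>e. e \<in> arcs r (2 * j) \<Longrightarrow> trail j e \<noteq> c \<Longrightarrow> fst e \<in> S \<Longrightarrow> snd e \<in> S"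
    and "entry (2 * j) \<in> S \<longleftrightarrow> exit r (2 * j) \<in> S"
    and "v \<in> verts r (2 * j)" "v \<in> S"
  shows "verts r (2 * j) \<subseteq> S"
  using assms
proof (induction j arbitrary: S c v)
  case (Suc j)
  define k where "k = 2 * j"
  have k: "2 * Suc j = Suc (Suc k)" by (simp add: k_def)
  note closed = Suc.prems(1)[unfolded k]
  have ends: "[0] \<in> S \<longleftrightarrow> [Suc r] \<in> S" using Suc.prems(2) by (simp add: k)
  have v: "v \<in> verts r (Suc (Suc k))" using Suc.prems(3) k by simp
  define C where "C i = {v. i # v \<in> S}" for i
  have outer_fwd: "fwd_stop r (Suc k) (Suc i) \<in> S"
    if "i \<le> r" "[i] \<noteq> c" "fwd_stop r (Suc k) i \<in> S" for i
    using closed[OF arcs_SucI(1), of i] that trail_simps(1) by simp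
  have outer_bwd: "bwd_stop r (Suc k) i \<in> S"
    if "i \<le> r" "[i] \<noteq> c" "bwd_stop r (Suc k) (Suc i) \<in> S" for i
    using closed[OF arcs_SucI(2), of i] that trail_simps(2) by simp
  have inner_fwd: "fwd_closed r k (C i)" if "i \<in> {1..r}" "[i - 1] \<noteq> c" for i
    unfolding fwd_closed_def C_def
    using closed[OF arcs_SucI(3)[OF _ _ arcs_SucI(1)], of i] that trail_simps(3) by auto
  have inner_bwd: "bwd_closed r k (C i)" if "i \<in> {1..r}" "[i] \<noteq> c" for i
    unfolding bwd_closed_def C_def
    using closed[OF arcs_SucI(3)[OF _ _ arcs_SucI(2)], of i] that trail_simps(4) by auto
  have deep: "snd e \<in> {v. i # l # v \<in> S}"
    if "i \<in> {1..r}" "l \<in> {1..r}" "e \<in> arcs r k" "i # l # trail j e \<noteq> c"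
      "fst e \<in> {v. i # l # v \<in> S}" for i l e
    using closed[OF arcs_SucI(3)[OF _ _ arcs_SucI(3)], of i l e] that trail_simps(5) by auto
  show ?case
  \<comment> \<open>For \<open>c = [m]\<close> only paths of the top two levels are damaged.
    Otherwise these remain intact, and at most one copy two levels down is damaged.\<close>
  proof (cases "\<exists>m. c = [m]")
    case True
    then obtain m where c: "c = [m]" by blast
    have full: "copies_full r k (C i)" if i: "i \<in> {1..r}" for i
      unfolding copies_full_def
    proof (intro ballI impI)
      fix l v assume l: "l \<in> {1..r}" and "\<exists>v\<in>verts r k. l # v \<in> C i" and v: "v \<in> verts r k"
      then obtain u where u: "u \<in> verts r k" "i # l # u \<in> S" by (auto simp: C_def)
      have "verts r k \<subseteq> {v. i # l # v \<in> S}"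
        by (rule arcs_connected[OF _ u(1)]) (use deep[OF i l] c u in auto)
      with v show "l # v \<in> C i" by (auto simp: C_def)
    qed
    \<comment> \<open>The side condition keeps the walk off the removed arcs between positions
      \<open>m\<close> and \<open>m + 1\<close>.\<close>
    have up: "fwd_stop r (Suc k) l \<in> S"
      if "i \<le> l" "fwd_stop r (Suc k) i \<in> S" "l \<le> Suc r" "l \<le> m \<or> m < i" for i l
      using that by (induction rule: dec_induct) (auto intro: outer_fwd simp: c)
    have down: "bwd_stop r (Suc k) i \<in> S"
      if "i \<le> l" "bwd_stop r (Suc k) l \<in> S" "l \<le> Suc r" "l \<le> m \<or> m < i" for i l
      using that by (induction rule: inc_induct) (auto intro: outer_bwd simp: c)
    \<comment> \<open>Copies up to \<open>m\<close> keep their forward path and reach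
      \<open>[0]\<close> through their exit; copies beyond \<open>m\<close> keep their backward path
      and reach \<open>[Suc r]\<close> through their entry. Since \<open>ends\<close> ties the
      terminals, both lie in \<open>S\<close>, and the same paths spread back into all
      copies.\<close>
    have left: "[0] \<in> S" if "i \<le> m" "i \<in> {1..r}" "u \<in> verts r (Suc k)" "i # u \<in> S" for i u
    proof -
      have "[Suc r] \<in> C i"
        by (rule fwd_reaches_exit[OF inner_fwd full]) (use that c in \<open>auto simp: C_def\<close>)
      then have "bwd_stop r (Suc k) i \<in> S" using that by (simp add: C_def stop_inner)
      then show ?thesis using down[of 0 i] that by simp
    qed
    have right: "[Suc r] \<in> S" if "m < i" "i \<in> {1..r}" "u \<in> verts r (Suc k)" "i # u \<in> S" for i u
    proof -
      have "[0] \<in> C i"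
        by (rule bwd_reaches_entry[OF inner_bwd full]) (use that c in \<open>auto simp: C_def\<close>)
      then have "fwd_stop r (Suc k) i \<in> S" using that by (simp add: C_def stop_inner)
      then show ?thesis using up[of i "Suc r"] that by simp
    qed
    have "[0] \<in> S"
      using v
    proof (cases rule: verts_Suc_cases)
      case (3 i u)
      with Suc.prems(4) show ?thesis
        using left[of i u] right[of i u] ends by (cases "i \<le> m") auto
    qed (use Suc.prems(4) ends in auto)
    then have S: "[0] \<in> S" "[Suc r] \<in> S" using ends by auto
    have "i # u \<in> S" if i: "1 \<le> i" "i \<le> r" and u: "u \<in> verts r (Suc k)" for i u
    proof (cases "i \<le> m")
      case True
      then have "fwd_stop r (Suc k) i \<in> S" using up[of 0 i] S(1) i by simp
      then have "[0] \<in> C i" using i by (simp add: C_def stop_inner)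
      then have "verts r (Suc k) \<subseteq> C i"
        by (intro fwd_from_entry[OF inner_fwd full]) (use i c True in auto)
      with u show ?thesis by (auto simp: C_def)
    next
      case False
      then have "bwd_stop r (Suc k) i \<in> S" using down[of i "Suc r"] S(2) i by simp
      then have "[Suc r] \<in> C i" using i by (simp add: C_def stop_inner)
      then have "verts r (Suc k) \<subseteq> C i"
        by (intro bwd_from_exit[OF inner_bwd full]) (use i c False in auto)
      with u show ?thesis by (auto simp: C_def)
    qed
    then show ?thesis using S unfolding k by (auto elim: verts_Suc_cases simp del: verts.simps)
  next
    case False
    have fwd: "fwd_closed r k (C i)" and bwd: "bwd_closed r k (C i)" if "i \<in> {1..r}" for i
      using inner_fwd inner_bwd that False by auto
    have "copies_full r k (C i)" if i: "i \<in> {1..r}" for i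
      unfolding copies_full_def
    proof (intro ballI impI)
      fix l v assume l: "l \<in> {1..r}" and "\<exists>v\<in>verts r k. l # v \<in> C i" and v: "v \<in> verts r k"
      then obtain u where u: "u \<in> verts r k" "i # l # u \<in> S" by (auto simp: C_def)
      have "entry k \<in> {v. i # l # v \<in> S} \<longleftrightarrow> exit r k \<in> {v. i # l # v \<in> S}"
        using ring_stops_iff[OF fwd[OF i] bwd[OF i], of l] l by (simp add: stop_inner C_def)
      then have "verts r k \<subseteq> {v. i # l # v \<in> S}"
        unfolding k_def
      \<comment> \<open>In a copy not addressed by \<open>c\<close> this forgoes a trail that is
        still present, which is harmless: a label other than \<open>tl (tl c)\<close> still gives a
        full label other than \<open>c\<close>.\<close>
      proof (intro Suc.IH[of "tl (tl c)" _ u])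
        fix e assume e: "e \<in> arcs r (2 * j)" "trail j e \<noteq> tl (tl c)" "fst e \<in> {v. i # l # v \<in> S}"
        then have "i # l # trail j e \<noteq> c" by auto
        with e show "snd e \<in> {v. i # l # v \<in> S}" using deep[OF i l] by (simp add: k_def)
      qed (use u in \<open>auto simp: k_def\<close>)
      with v show "l # v \<in> C i" by (auto simp: C_def)
    qed
    then have inner: "verts r (Suc k) \<subseteq> C i" if "i \<in> {1..r}" "u \<in> verts r (Suc k)" "u \<in> C i" for i u
      using ring_full[OF fwd bwd] that by blast
    show ?thesis
      unfolding k
    proof (rule ring_full[OF _ _ _ v Suc.prems(4)])
      show "fwd_closed r (Suc k) S" using outer_fwd False by (auto simp: fwd_closed_def)
      show "bwd_closed r (Suc k) S" using outer_bwd False by (auto simp: bwd_closed_def)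
      show "copies_full r (Suc k) S"
        unfolding copies_full_def using inner unfolding C_def by blast
    qed
  qed
qed simp

section \<open>Cost of integral flows in rings\<close>

text \<open>The case of net flow zero: both parallel arcs carry \<open>f i\<close>, which vanishes
  at most once. The strengthened induction separates no zero so far, a zero now, and an earlier
  zero; the summand \<open>f r\<close> in the bound helps to pay for the next change.\<close>

lemma two_sum_minus_changes_ge:
  fixes f :: "nat \<Rightarrow> int"
  assumes "\<And>i. i \<le> r \<Longrightarrow> f i \<ge> 0"
    and "\<And>i l. i < l \<Longrightarrow> l \<le> r \<Longrightarrow> f i \<noteq> 0 \<or> f l \<noteq> 0"
  shows "2 * int r - 4 \<le> 2 * (\<Sum>i\<le>r. f i) - (\<Sum>i=1..r. of_bool (f (i - 1) \<noteq> f i))"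
proof -
  let ?D = "\<lambda>r. 2 * (\<Sum>i\<le>r. f i) - (\<Sum>i=1..r. of_bool (f (i - 1) \<noteq> f i))"
  have "(if \<forall>i\<le>r. f i \<noteq> 0 then 2 * int r + 1 + f r
         else if f r = 0 then 2 * int r - 1 else 2 * int r - 3 + f r) \<le> ?D r"
    using assms
  proof (induction r)
    case 0
    then show ?case using "0.prems"(1)[of 0] by auto
  next
    case (Suc r)
    have nn: "f r \<ge> 0" "f (Suc r) \<ge> 0" using Suc.prems(1) by auto
    have IH: "(if \<forall>i\<le>r. f i \<noteq> 0 then 2 * int r + 1 + f r
         else if f r = 0 then 2 * int r - 1 else 2 * int r - 3 + f r) \<le> ?D r"
      using Suc.IH Suc.prems by simp
    have step: "?D (Suc r) = ?D r + 2 * f (Suc r) - of_bool (f r \<noteq> f (Suc r))"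
      by simp
    have all: "(\<forall>i\<le>Suc r. f i \<noteq> 0) \<longleftrightarrow> (\<forall>i\<le>r. f i \<noteq> 0) \<and> f (Suc r) \<noteq> 0"
      by (auto simp: le_Suc_eq)
    have last: "\<forall>i\<le>r. f i \<noteq> 0" if "f (Suc r) = 0"
      using Suc.prems(2)[of _ "Suc r"] that by auto
    show ?case
    proof (cases "\<forall>i\<le>r. f i \<noteq> 0")
      case True
      then have "f r \<noteq> 0" by simp
      with True IH nn show ?thesis unfolding step all by (auto simp: of_bool_def)
    next
      case False
      then have "f (Suc r) \<noteq> 0" using last by blast
      with False IH nn show ?thesis unfolding step all by (auto simp: of_bool_def split: if_splits)
    qed
  qed
  moreover have "f r \<ge> 0" using assms(1) by simp
  ultimately show ?thesis by (auto split: if_splits)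
qed

text \<open>The case of nonzero net flow: \<open>f i + b i = 2 * f i - a\<close> is at least 1 and
  moves by at least 2 whenever \<open>f\<close> changes, so two neighbouring sums add up to 2, and
  to 4 at a change.\<close>

lemma sum_minus_changes_ge:
  fixes f b :: "nat \<Rightarrow> int"
  assumes "\<And>i. i \<le> r \<Longrightarrow> f i \<ge> 0 \<and> b i \<ge> 0 \<and> f i - b i = a" "a \<noteq> 0"
  shows "int r \<le> (\<Sum>i\<le>r. f i + b i) - (\<Sum>i=1..r. of_bool (f (i - 1) \<noteq> f i))"
proof -
  let ?D = "\<lambda>r. (\<Sum>i\<le>r. f i + b i) - (\<Sum>i=1..r. of_bool (f (i - 1) \<noteq> f i))"
  have "2 * int r + (f r + b r) + 1 \<le> 2 * ?D r"
    using assms(1)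
  proof (induction r)
    case 0
    then show ?case using "0.prems"[of 0] assms(2) by auto
  next
    case (Suc r)
    have IH: "2 * int r + (f r + b r) + 1 \<le> 2 * ?D r"
      using Suc.IH Suc.prems by simp
    have step: "?D (Suc r) = ?D r + (f (Suc r) + b (Suc r)) - of_bool (f r \<noteq> f (Suc r))"
      by simp
    have "f r \<ge> 0 \<and> b r \<ge> 0 \<and> f r - b r = a" "f (Suc r) \<ge> 0 \<and> b (Suc r) \<ge> 0 \<and> f (Suc r) - b (Suc r) = a"
      using Suc.prems[of r] Suc.prems[of "Suc r"] by auto
    then have "f (Suc r) + b (Suc r) + (f r + b r) \<ge> 2 + 2 * of_bool (f r \<noteq> f (Suc r))"
      using assms(2) by (cases "f r = f (Suc r)") (simp; presburger)+
    with IH show ?case unfolding step by (simp add: algebra_simps)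
  qed
  moreover have "f r + b r \<ge> 0" using assms(1)[of r] by simp
  moreover have "p \<le> q" if "2 * p + s + 1 \<le> 2 * q" "s \<ge> 0" for p q s :: int
    using that by linarith
  ultimately show ?thesis by blast
qed

text \<open>Mirrors the recursion of the total weight, with \<open>2 * r - 4\<close> instead of the
  \<open>2 * (r + 1)\<close> outer arcs.\<close>

fun flow_bound :: "nat \<Rightarrow> nat \<Rightarrow> int" where
  "flow_bound r 0 = 0"
| "flow_bound r (Suc k) = int r * flow_bound r k + int r ^ k * (2 * int r - 4)"

lemma wt_simps:
  "wt r (Suc k) (fwd_arc r k i) = r ^ k" "wt r (Suc k) (bwd_arc r k i) = r ^ k"
  "wt r (Suc k) (lift i e) = wt r k e"
  by simp_all

text \<open>Here \<open>a\<close> is the net flow from entry to exit, and a nonzero one may save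
  \<open>r ^ k\<close>. Copy \<open>i\<close> has net flow \<open>f (i - 1) - f i\<close>, so each
  change of \<open>f\<close> saves at most the weight of one outer arc, and the two preceding lemmas
  bound the outer arcs minus the changes.\<close>

lemma flow_cost_ge:
  fixes z :: "nat list \<times> nat list \<Rightarrow> int"
  assumes "\<And>e. e \<in> arcs r k \<Longrightarrow> z e \<ge> 0"
    and "\<And>\<phi>. (\<Sum>e\<in>arcs r k. (\<phi> (fst e) - \<phi> (snd e)) * z e) = a * (\<phi> (entry k) - \<phi> (exit r k))"
    and "\<And>S. S \<noteq> {} \<Longrightarrow> S \<subseteq> verts r k - {entry k, exit r k} \<Longrightarrow>
      \<exists>e\<in>arcs r k. z e > 0 \<and> fst e \<in> S \<and> snd e \<notin> S"
  shows "flow_bound r k - (if a = 0 then 0 else int r ^ k) \<le> (\<Sum>e\<in>arcs r k. int (wt r k e) * z e)"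
  using assms
proof (induction k arbitrary: z a)
  case 0
  then show ?case by simp
next
  case (Suc k)
  note nonneg = Suc.prems(1) and cut = Suc.prems(3)
  have bal: "(\<Sum>i\<le>r. (\<phi> (fwd_stop r k i) - \<phi> (fwd_stop r k (Suc i))) * z (fwd_arc r k i))
    + (\<Sum>i\<le>r. (\<phi> (bwd_stop r k (Suc i)) - \<phi> (bwd_stop r k i)) * z (bwd_arc r k i))
    + (\<Sum>i=1..r. \<Sum>e\<in>arcs r k. (\<phi> (i # fst e) - \<phi> (i # snd e)) * z (lift i e))
    = a * (\<phi> [0] - \<phi> [Suc r])" for \<phi>
    using Suc.prems(2)[of \<phi>] by (simp only: sum_arcs_Suc arc_ends entry.simps exit.simps)
  define f where "f i = z (fwd_arc r k i)" for i
  define b where "b i = z (bwd_arc r k i)" for i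
  have fb0: "f i \<ge> 0" "b i \<ge> 0" if "i \<le> r" for i
    using nonneg[OF arcs_SucI(1)[OF that]] nonneg[OF arcs_SucI(2)[OF that]] by (simp_all add: f_def b_def)
  \<comment> \<open>The potential used separates the positions up to \<open>i\<close> from the later
    ones.\<close>
  have net: "f i - b i = a" if i: "i \<le> r" for i
  proof -
    have "(\<Sum>l\<le>r. (of_bool (l \<le> i) - of_bool (Suc l \<le> i)) * f l) = (\<Sum>l\<le>r. if l = i then f l else 0)"
      by (rule sum.cong) auto
    moreover have "(\<Sum>l\<le>r. (of_bool (Suc l \<le> i) - of_bool (l \<le> i)) * b l) = (\<Sum>l\<le>r. if l = i then - b l else 0)"
      by (rule sum.cong) auto
    ultimately show ?thesis
      using bal[of "\<lambda>v. of_bool (hd v \<le> i)"] i by (simp add: f_def b_def)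
  qed
  have copy: "flow_bound r k - int r ^ k * of_bool (f (i - 1) \<noteq> f i)
      \<le> (\<Sum>e\<in>arcs r k. int (wt r k e) * z (lift i e))" if i: "i \<in> {1..r}" for i
  proof -
    have "flow_bound r k - (if f (i - 1) - f i = 0 then 0 else int r ^ k)
      \<le> (\<Sum>e\<in>arcs r k. int (wt r k e) * z (lift i e))"
    proof (rule Suc.IH)
      show "z (lift i e) \<ge> 0" if "e \<in> arcs r k" for e
        by (rule nonneg, rule arcs_SucI(3)) (use i that in auto)
    next
      fix \<phi> :: "nat list \<Rightarrow> int"
      \<comment> \<open>Extending the potential by zero isolates copy \<open>i\<close>. The surplus
        \<open>f (i - 1) - f i\<close> enters at its entry and, by \<open>net\<close>, leaves at its
        exit.\<close>
      define \<psi> where "\<psi> v = (if hd v = i then \<phi> (tl v) else 0)" for v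
      have "\<psi> (fwd_stop r k l) = (if l = i then \<phi> (entry k) else 0)"
        "\<psi> (bwd_stop r k l) = (if l = i then \<phi> (exit r k) else 0)" for l
        using i by (auto simp: \<psi>_def stop_inner)
      then have "(\<Sum>l\<le>r. (\<psi> (fwd_stop r k l) - \<psi> (fwd_stop r k (Suc l))) * f l)
          = (\<Sum>l\<le>r. (if l = i then \<phi> (entry k) * f i else 0) - (if l = i - 1 then \<phi> (entry k) * f (i - 1) else 0))"
        and "(\<Sum>l\<le>r. (\<psi> (bwd_stop r k (Suc l)) - \<psi> (bwd_stop r k l)) * b l)
          = (\<Sum>l\<le>r. (if l = i - 1 then \<phi> (exit r k) * b (i - 1) else 0) - (if l = i then \<phi> (exit r k) * b i else 0))"
        using i by (auto intro!: sum.cong)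
      moreover have "(\<Sum>l=1..r. \<Sum>e\<in>arcs r k. (\<psi> (l # fst e) - \<psi> (l # snd e)) * z (lift l e))
          = (\<Sum>l=1..r. if l = i then \<Sum>e\<in>arcs r k. (\<phi> (fst e) - \<phi> (snd e)) * z (lift i e) else 0)"
        by (rule sum.cong) (auto simp: \<psi>_def)
      moreover have "\<psi> [0] = 0" "\<psi> [Suc r] = 0" using i by (auto simp: \<psi>_def)
      moreover have le: "i - 1 \<le> r" "i \<le> r" using i by auto
      ultimately have "(\<phi> (entry k) * f i - \<phi> (entry k) * f (i - 1)) + (\<phi> (exit r k) * b (i - 1) - \<phi> (exit r k) * b i)
        + (\<Sum>e\<in>arcs r k. (\<phi> (fst e) - \<phi> (snd e)) * z (lift i e)) = 0"
        using bal[of \<psi>] i by (simp add: sum_subtractf flip: f_def b_def)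
      moreover have "\<phi> (exit r k) * b (i - 1) - \<phi> (exit r k) * b i
          = \<phi> (exit r k) * f (i - 1) - \<phi> (exit r k) * f i"
        using net[OF le(1)] net[OF le(2)] by (simp flip: right_diff_distrib)
      moreover have "(f (i - 1) - f i) * (\<phi> (entry k) - \<phi> (exit r k)) =
          \<phi> (entry k) * f (i - 1) - \<phi> (entry k) * f i
            - (\<phi> (exit r k) * f (i - 1) - \<phi> (exit r k) * f i)"
        by (simp add: algebra_simps)
      ultimately show "(\<Sum>e\<in>arcs r k. (\<phi> (fst e) - \<phi> (snd e)) * z (lift i e))
          = (f (i - 1) - f i) * (\<phi> (entry k) - \<phi> (exit r k))"
        by linarith
    next
      fix S assume S: "S \<noteq> {}" "S \<subseteq> verts r k - {entry k, exit r k}"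
      \<comment> \<open>Outer arcs touch copy \<open>i\<close> only at its entry and exit, which
        \<open>S\<close> avoids, so the arc found by \<open>cut\<close> lies inside the
        copy.\<close>
      have "(#) i ` S \<subseteq> verts r (Suc k) - {entry (Suc k), exit r (Suc k)}"
        using S(2) i Cons_in_verts[of i r _ k] by (auto simp del: verts.simps)
      then obtain e where e: "e \<in> arcs r (Suc k)" "z e > 0" "fst e \<in> (#) i ` S" "snd e \<notin> (#) i ` S"
        using cut[of "(#) i ` S"] S(1) by blast
      from e(3) have hd: "hd (fst e) = i" and tl: "tl (fst e) \<in> S" by auto
      from e(1) consider l where "l \<le> r" "e = fwd_arc r k l" | l where "l \<le> r" "e = bwd_arc r k l"
        | l e' where "l \<in> {1..r}" "e' \<in> arcs r k" "e = lift l e'"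
        by auto
      then show "\<exists>e\<in>arcs r k. z (lift i e) > 0 \<and> fst e \<in> S \<and> snd e \<notin> S"
      proof cases
        case (1 l)
        with hd tl S(2) i show ?thesis by (auto simp: stop_inner)
      next
        case (2 l)
        with hd tl S(2) i show ?thesis by (auto simp: stop_inner)
      next
        case (3 l e')
        with hd tl e show ?thesis by (intro bexI[of _ e']) auto
      qed
    qed
    then show ?thesis by (auto split: if_splits)
  qed
  have zero: "f i \<noteq> 0 \<or> b i \<noteq> 0 \<or> f l \<noteq> 0 \<or> b l \<noteq> 0" if il: "i < l" "l \<le> r" for i l
  proof (rule ccontr)
    assume no: "\<not> ?thesis"
    \<comment> \<open>The copies after \<open>i\<close> up to \<open>l\<close> can be left only by
      the forward arc at \<open>l\<close> and the backward arc at \<open>i\<close>.\<close>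
    let ?S = "{v \<in> verts r (Suc k). i < hd v \<and> hd v \<le> l}"
    have "fwd_stop r k l \<in> ?S" using il stop_in_verts by simp
    then have "?S \<noteq> {}" by blast
    moreover have "?S \<subseteq> verts r (Suc k) - {entry (Suc k), exit r (Suc k)}"
      using il by auto
    ultimately obtain e where e: "e \<in> arcs r (Suc k)" "z e > 0" "fst e \<in> ?S" "snd e \<notin> ?S"
      using cut[of ?S] by blast
    have "snd e \<in> verts r (Suc k)" using subsetD[OF arcs_subset e(1)]
      by (simp add: mem_Times_iff del: verts.simps)
    with e(3,4) have h: "i < hd (fst e)" "hd (fst e) \<le> l" "hd (snd e) \<le> i \<or> l < hd (snd e)"
      by (auto simp del: verts.simps)
    from e(1) consider m where "e = fwd_arc r k m" | m where "e = bwd_arc r k m"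
      | m e' where "e = lift m e'"
      by auto
    then show False
    proof cases
      case (1 m)
      with h have "m = l" by auto
      with 1 e(2) no show False by (simp add: f_def)
    next
      case (2 m)
      with h have "m = i" by auto
      with 2 e(2) no show False by (simp add: b_def)
    next
      case 3
      with h show False by auto
    qed
  qed
  let ?m = "\<Sum>i=1..r. of_bool (f (i - 1) \<noteq> f i) :: int"
  let ?s = "\<Sum>i\<le>r. f i + b i"
  have "(\<Sum>e\<in>arcs r (Suc k). int (wt r (Suc k) e) * z e)
      = int r ^ k * ?s + (\<Sum>i=1..r. \<Sum>e\<in>arcs r k. int (wt r k e) * z (lift i e))"
    unfolding sum_arcs_Suc wt_simps
    by (simp add: f_def b_def sum.distrib sum_distrib_left distrib_left)
  also have "\<dots> \<ge> int r ^ k * ?s + (\<Sum>i=1..r. flow_bound r k - int r ^ k * of_bool (f (i - 1) \<noteq> f i))"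
    by (intro add_left_mono sum_mono) (rule copy)
  also have "int r ^ k * ?s + (\<Sum>i=1..r. flow_bound r k - int r ^ k * of_bool (f (i - 1) \<noteq> f i))
      = int r * flow_bound r k + int r ^ k * (?s - ?m)"
    by (simp add: sum_subtractf sum_distrib_left right_diff_distrib)
  finally have cost: "int r * flow_bound r k + int r ^ k * (?s - ?m)
      \<le> (\<Sum>e\<in>arcs r (Suc k). int (wt r (Suc k) e) * z e)" .
  have "2 * int r - 4 - (if a = 0 then 0 else int r) \<le> ?s - ?m"
  proof (cases "a = 0")
    case True
    then have "b i = f i" if "i \<le> r" for i using net that by force
    then have "?s = 2 * (\<Sum>i\<le>r. f i)" by (simp add: sum_distrib_left)
    moreover have "f i \<noteq> 0 \<or> f l \<noteq> 0" if "i < l" "l \<le> r" for i l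
      using zero[OF that] \<open>\<And>i. i \<le> r \<Longrightarrow> b i = f i\<close>[of i] \<open>\<And>i. i \<le> r \<Longrightarrow> b i = f i\<close>[of l] that by auto
    ultimately show ?thesis
      using two_sum_minus_changes_ge[of r f] fb0(1) True by simp
  next
    case False
    then show ?thesis using sum_minus_changes_ge[of r f b a] fb0 net by simp
  qed
  from mult_left_mono[OF this, of "int r ^ k"]
  have "int r ^ k * (2 * int r - 4 - (if a = 0 then 0 else int r)) \<le> int r ^ k * (?s - ?m)" by simp
  moreover have "flow_bound r (Suc k) - (if a = 0 then 0 else int r ^ Suc k)
      = int r * flow_bound r k + int r ^ k * (2 * int r - 4 - (if a = 0 then 0 else int r))"
    by (simp add: algebra_simps)
  ultimately show ?case using cost by linarith
qed

section \<open>The gap instances\<close>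

lemma wt_pos: "r \<ge> 1 \<Longrightarrow> wt r k e \<ge> 1"
  by (induction k arbitrary: e) auto

lemma flow_bound_closed_form: "flow_bound r (Suc k) = int (Suc k) * int r ^ k * (2 * int r - 4)"
proof (induction k)
  case (Suc k)
  then show ?case by (simp only: flow_bound.simps(2)[of r "Suc k"]) (simp add: algebra_simps)
qed simp

text \<open>The weights are chosen so that each of the \<open>Suc k\<close> levels carries the same
  total \<open>2 * Suc r * r ^ k\<close>.\<close>

lemma sum_wt: "(\<Sum>e\<in>arcs r (Suc k). wt r (Suc k) e) = 2 * Suc k * Suc r * r ^ k"
proof (induction k)
  case 0
  show ?case by (subst sum_arcs_Suc) (simp add: wt_simps del: wt.simps arcs.simps(2))
next
  case (Suc k)
  have "(\<Sum>e\<in>arcs r (Suc (Suc k)). wt r (Suc (Suc k)) e)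
      = 2 * (Suc r * r ^ Suc k) + r * (\<Sum>e\<in>arcs r (Suc k). wt r (Suc k) e)"
    by (subst sum_arcs_Suc) (simp add: wt_simps del: wt.simps arcs.simps(2))
  also have "\<dots> = 2 * Suc (Suc k) * Suc r * r ^ Suc k"
    by (simp only: Suc.IH) (simp add: algebra_simps)
  finally show ?case .
qed

text \<open>They tie entry and exit at the top level, as \<open>arcs_robust\<close> demands, and add
  only 2 to the total weight.\<close>

definition closing_arcs :: "nat \<Rightarrow> nat \<Rightarrow> (nat list \<times> nat list) set" where
  "closing_arcs r k = {(entry k, exit r k), (exit r k, entry k)}"

lemma closing_arcs_disjoint:
  assumes "r \<ge> 1" "k \<ge> 1"
  shows "arcs r k \<inter> closing_arcs r k = {}"
proof -
  obtain k' where k: "k = Suc k'" using assms(2) by (cases k) auto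
  have "(hd (fst e), hd (snd e)) \<noteq> (0, Suc r)" "(hd (fst e), hd (snd e)) \<noteq> (Suc r, 0)"
    if "e \<in> arcs r k" for e
    using that assms(1) unfolding k by auto
  moreover have "e = ([0], [Suc r]) \<or> e = ([Suc r], [0])" if "e \<in> closing_arcs r k" for e
    using that by (simp add: closing_arcs_def k)
  ultimately show ?thesis by fastforce
qed

text \<open>The level is even because trails span two levels. The closing arcs form the extra class
  \<open>None\<close>: without it the ring is connected by \<open>arcs_connected\<close>, and
  without a trail the closing arcs allow \<open>arcs_robust\<close>.\<close>

lemma ring_gap_instance:
  assumes r: "r \<ge> 1" and j: "j \<ge> 1" and k: "k = 2 * j"
  shows "gap_instance (verts r k) (arcs r k \<union> closing_arcs r k)
    (\<lambda>e. if e \<in> arcs r k then wt r k e else 1)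
    (\<lambda>e. if e \<in> arcs r k then Some (trail j e) else None)
    (flow_bound r k - int r ^ k)"
proof -
  let ?A = "arcs r k" and ?B = "closing_arcs r k"
  let ?cls = "\<lambda>e. if e \<in> arcs r k then Some (trail j e) else None"
  have k1: "k \<ge> 1" using j k by simp
  then obtain k' where k': "k = Suc k'" by (cases k) auto
  have pq: "entry k = [0]" "exit r k = [Suc r]" by (simp_all add: k')
  have disj: "?A \<inter> ?B = {}" by (rule closing_arcs_disjoint[OF r k1])
  have finB: "finite ?B" by (simp add: closing_arcs_def)
  have split: "(\<Sum>e\<in>?A \<union> ?B. g e) = (\<Sum>e\<in>?A. g e) + g (entry k, exit r k) + g (exit r k, entry k)"
    for g :: "_ \<Rightarrow> 'x :: comm_monoid_add"
  proof -
    have "(\<Sum>e\<in>?B. g e) = g (entry k, exit r k) + g (exit r k, entry k)"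
      unfolding closing_arcs_def pq by simp
    then show ?thesis by (simp add: sum.union_disjoint[OF _ finB disj] add.assoc)
  qed
  have notA: "(entry k, exit r k) \<notin> ?A" "(exit r k, entry k) \<notin> ?A"
    using disj by (auto simp: closing_arcs_def)
  show ?thesis
  proof
    show "finite (verts r k)" by (rule finite_verts)
    have "card {entry k, exit r k} \<le> card (verts r k)"
      by (rule card_mono[OF finite_verts]) (use entry_exit_in_verts in auto)
    then show "2 \<le> card (verts r k)" by (simp add: pq)
    show "?A \<union> ?B \<subseteq> verts r k \<times> verts r k"
      using arcs_subset entry_exit_in_verts by (auto simp: closing_arcs_def)
    show "fst e \<noteq> snd e" if "e \<in> ?A \<union> ?B" for e
      using that arcs_no_loop by (auto simp: closing_arcs_def pq)
    show "1 \<le> (if e \<in> ?A then wt r k e else 1)" if "e \<in> ?A \<union> ?B" for e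
      using wt_pos[OF r] by simp
    show "(\<Sum>e\<in>?A \<union> ?B. if ?cls e = c then \<phi> (fst e) - \<phi> (snd e) else 0) = 0"
      for c and \<phi> :: "nat list \<Rightarrow> real"
    proof (cases c)
      case None
      then show ?thesis unfolding split using notA by simp
    next
      case (Some t)
      have "(\<Sum>e\<in>?A. if ?cls e = c then \<phi> (fst e) - \<phi> (snd e) else 0)
          = (\<Sum>e\<in>?A. if trail j e = t then \<phi> (fst e) - \<phi> (snd e) else 0)"
        by (rule sum.cong) (auto simp: Some)
      also have "\<dots> = 0" unfolding k by (rule trail_balanced)
      finally show ?thesis unfolding split using notA by (simp add: Some)
    qed
    show "\<exists>e\<in>?A \<union> ?B. ?cls e \<noteq> c \<and> fst e \<in> S \<and> snd e \<notin> S"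
      if S: "S \<noteq> {}" "S \<subset> verts r k" for c S
    proof (rule ccontr)
      assume no: "\<not> ?thesis"
      obtain v where v: "v \<in> S" "v \<in> verts r k" using S by blast
      have "verts r k \<subseteq> S"
      proof (cases c)
        case None
        with no have "\<And>e. e \<in> ?A \<Longrightarrow> fst e \<in> S \<Longrightarrow> snd e \<in> S" by auto
        then show ?thesis by (rule arcs_connected[OF _ v(2,1)])
      next
        case (Some t)
        with no notA have "entry k \<in> S \<longleftrightarrow> exit r k \<in> S"
          by (fastforce simp: closing_arcs_def)
        moreover have "snd e \<in> S" if "e \<in> ?A" "trail j e \<noteq> t" "fst e \<in> S" for e
          using no that Some by auto
        ultimately show ?thesis using v unfolding k by (intro arcs_robust[of r j t S v])
      qed
      with S show False by blast
    qed
    show "flow_bound r k - int r ^ k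
        \<le> int (\<Sum>e\<in>?A \<union> ?B. (if e \<in> ?A then wt r k e else 1) * z e)"
      if bal: "\<And>\<phi> :: _ \<Rightarrow> int. (\<Sum>e\<in>?A \<union> ?B. (\<phi> (fst e) - \<phi> (snd e)) * int (z e)) = 0"
        and cut: "\<And>S. S \<noteq> {} \<Longrightarrow> S \<subset> verts r k \<Longrightarrow>
          \<exists>e\<in>?A \<union> ?B. z e > 0 \<and> fst e \<in> S \<and> snd e \<notin> S" for z
    proof -
      \<comment> \<open>What the closing arcs return from exit to entry is the net flow through the
        ring. It may be nonzero, hence the loss \<open>r ^ k\<close> in the bound.\<close>
      define a where "a = int (z (exit r k, entry k)) - int (z (entry k, exit r k))"
      have "flow_bound r k - (if a = 0 then 0 else int r ^ k) \<le> (\<Sum>e\<in>?A. int (wt r k e) * int (z e))"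
      proof (rule flow_cost_ge)
        show "(\<Sum>e\<in>?A. (\<phi> (fst e) - \<phi> (snd e)) * int (z e)) = a * (\<phi> (entry k) - \<phi> (exit r k))" for \<phi>
          using bal[of \<phi>] unfolding split by (simp add: a_def algebra_simps)
      next
        fix S assume S: "S \<noteq> {}" "S \<subseteq> verts r k - {entry k, exit r k}"
        then have "S \<subset> verts r k" using entry_exit_in_verts by blast
        from cut[OF S(1) this] S(2) show "\<exists>e\<in>?A. int (z e) > 0 \<and> fst e \<in> S \<and> snd e \<notin> S"
          by (auto simp: closing_arcs_def)
      qed simp
      moreover have "flow_bound r k - int r ^ k \<le> flow_bound r k - (if a = 0 then 0 else int r ^ k)" by simp
      moreover have "(\<Sum>e\<in>?A. int (wt r k e) * int (z e))
          \<le> int (\<Sum>e\<in>?A \<union> ?B. (if e \<in> ?A then wt r k e else 1) * z e)"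
        unfolding split by (simp add: notA)
      ultimately show ?thesis by linarith
    qed
  qed
qed

theorem theorem1:
  fixes \<epsilon> :: real
  assumes "\<epsilon> > 0"
  shows "\<exists>n\<ge>2. \<exists>d :: nat \<times> nat \<Rightarrow> real.
    (\<forall>e\<in>K_edges n. d e \<ge> 0) \<and>
    (\<forall>u\<in>K_verts n. \<forall>v\<in>K_verts n. \<forall>w\<in>K_verts n.
       u \<noteq> v \<and> v \<noteq> w \<and> u \<noteq> w \<longrightarrow> d (u, w) \<le> d (u, v) + d (v, w)) \<and>
    (\<exists>x y. is_arg_min (tour_cost n d) (\<lambda>z. z \<in> AT_int n) x \<and>
           is_arg_min (tour_cost n d) (\<lambda>z. z \<in> LS_N (K_edges n) (AT_bal n)) y \<and>
           tour_cost n d y > 0 \<and>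
           tour_cost n d x / tour_cost n d y \<ge> 3 / 2 - \<epsilon>)"
proof -
  \<comment> \<open>Branching and level are both \<open>r\<close>: large branching brings
    \<open>2 * r - 4\<close> close to \<open>2 * r + 2\<close>, and a large level makes the loss
    \<open>r ^ k\<close> small against the bound. The choice gives
    \<open>r * \<epsilon> \<ge> 8\<close>.\<close>
  define j where "j = nat \<lceil>4 / \<epsilon>\<rceil> + 2"
  define r where "r = 2 * j"
  have j: "j \<ge> 2" "real j \<ge> 4 / \<epsilon>" by (simp_all add: j_def) linarith
  have r: "r \<ge> 4" using j by (simp add: r_def)
  obtain k where k: "r = Suc k" using r by (cases r) auto
  let ?E = "arcs r r \<union> closing_arcs r r" and ?w = "\<lambda>e. if e \<in> arcs r r then wt r r e else 1"
  define T where "T = flow_bound r r - int r ^ r"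
  obtain g where g: "bij_betw g (verts r r) {..<card (verts r r)}"
    using ex_bij_betw_finite_nat[OF finite_verts, of r r] unfolding atLeast0LessThan by (elim exE)
  define h where "h = map_prod (inv_into (verts r r) g) (inv_into (verts r r) g)"
  have gap: "gap_instance (verts r r) ?E ?w (\<lambda>e. if e \<in> arcs r r then Some (trail j e) else None) T"
    unfolding T_def by (rule ring_gap_instance[OF _ _ r_def]) (use r j in auto)
  interpret nat_gap_instance "card (verts r r)" "map_prod g g ` ?E" "?w \<circ> h"
    "(\<lambda>e. if e \<in> arcs r r then Some (trail j e) else None) \<circ> h" T
    unfolding nat_gap_instance_def h_def by (rule gap_instance_transport[OF gap g])
  have W: "(\<Sum>e\<in>map_prod g g ` ?E. (?w \<circ> h) e) = 2 * r * Suc r * r ^ k + 2"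
  proof -
    have E: "?E \<subseteq> verts r r \<times> verts r r" using gap by (rule gap_instance.E_subset)
    have gi: "inj_on g (verts r r)" using g by (rule bij_betw_imp_inj_on)
    then have inj: "inj_on (map_prod g g) ?E"
      using E map_prod_inj_on inj_on_subset by blast
    have "(\<Sum>e\<in>map_prod g g ` ?E. (?w \<circ> h) e) = (\<Sum>e\<in>?E. ?w e)"
      unfolding sum.reindex[OF inj] using E gi by (intro sum.cong) (auto simp: h_def)
    also have "\<dots> = (\<Sum>e\<in>arcs r r. ?w e) + (\<Sum>e\<in>closing_arcs r r. ?w e)"
      by (rule sum.union_disjoint)
         (use closing_arcs_disjoint[of r r] r in \<open>auto simp: closing_arcs_def\<close>)
    also have "(\<Sum>e\<in>arcs r r. ?w e) = 2 * r * Suc r * r ^ k"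
      using sum_wt[of r k] by (simp add: k)
    also have "(\<Sum>e\<in>closing_arcs r r. ?w e) = (\<Sum>e\<in>closing_arcs r r. 1)"
      by (rule sum.cong) (use closing_arcs_disjoint[of r r] r in auto)
    also have "\<dots> = 2" by (simp add: closing_arcs_def k)
    finally show ?thesis .
  qed
  let ?R = "real r ^ r"
  have R: "?R \<ge> 1" using r by simp
  have W': "real (\<Sum>e\<in>map_prod g g ` ?E. (?w \<circ> h) e) \<le> ?R * (2 * real r + 4)"
  proof -
    have "real (2 * r * Suc r * r ^ k + 2) = ?R * (2 * real r + 2) + 2"
      by (simp add: k algebra_simps)
    then show ?thesis unfolding W using R by (simp add: algebra_simps)
  qed
  have T: "real_of_int T = ?R * (2 * real r - 5)"
    unfolding T_def k flow_bound_closed_form by (simp add: algebra_simps)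
  have "1 - 2 * \<epsilon> / 3 \<le> (2 * real r - 5) / (2 * real r + 4)"
  proof -
    \<comment> \<open>With denominators cleared the claim reads
      \<open>27 \<le> \<epsilon> * (4 * r + 8)\<close>.\<close>
    have "real r * \<epsilon> \<ge> 8" using j(2) assms by (simp add: r_def field_simps)
    then show ?thesis using assms by (simp add: field_simps)
  qed
  also have "\<dots> = real_of_int T / (?R * (2 * real r + 4))"
    unfolding T using R r by simp
  also have "\<dots> \<le> real_of_int T / real (\<Sum>e\<in>map_prod g g ` ?E. (?w \<circ> h) e)"
  proof (rule divide_left_mono[OF W'])

    show "0 \<le> real_of_int T" unfolding T using r R by simp
    show "0 < ?R * (2 * real r + 4) * real (\<Sum>e\<in>map_prod g g ` ?E. (?w \<circ> h) e)"
    proof (intro mult_pos_pos)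
      show "0 < ?R" using R by linarith
      show "0 < 2 * real r + 4" by (simp add: add_nonneg_pos)
      show "0 < real (\<Sum>e\<in>map_prod g g ` ?E. (?w \<circ> h) e)"
        unfolding W by (simp only: of_nat_0_less_iff)
    qed
  qed
  finally have ratio: "3 / 2 - \<epsilon> \<le> 3 / 2 * (real_of_int T / real (\<Sum>e\<in>map_prod g g ` ?E. (?w \<circ> h) e))"
    by linarith
  have n: "card (verts r r) \<ge> 2" using card_V by simp
  show ?thesis
    using integrality_gap
    by (intro exI[of _ "card (verts r r)"] conjI[OF n], elim ex_forward conj_forward)
       (assumption | rule order_trans[OF ratio])+
qed

end
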